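(* Let $\lambda$ be regular, let $X, Y\in\mathscr{M}_\lambda$, and suppose that $Y$ is spherically complete. Let $1\le\xi<\lambda^+$ be either a successor ordinal or a limit ordinal of cofinality $\lambda$. Then \[\mathcal{M}_{\xi+1}(X,Y)=\lambda\text{-}\!\lim\mathcal{M}_\xi(X,Y).\] If $\xi$ is a limit ordinal, then moreover \[\mathcal{M}_{\xi+1}(X,Y)=\lambda\text{-}\!\lim\mathcal{M}_{<\xi}(X,Y).\]
   Context: Work in ZFC. $\lambda$ is an uncountable cardinal with $2^{<\lambda}=\lambda$; since $\lambda$ is regular, $\mu=\operatorname{cof}(\lambda)=\lambda$. All spaces are regular Hausdorff. $\mathbb{G}$ is a fixed ordered field with $\mathbb{G}^+$ of coinitiality $\lambda$; $\mathscr{M}_\lambda$ is the class of spaces of weight $\le\lambda$ whose topology is induced by a $\mathbb{G}$-valued metric. $Y$ is spherically complete if it admits a compatible $\mathbb{G}$-metric in which every decreasing sequence of closed balls has nonempty intersection. $\boldsymbol{\Sigma}^0_1(X)$ = open sets; for $1<\xi<\lambda^+$, $\boldsymbol{\Sigma}^0_\xi(X)$ = all unions $\bigcup_{i<\lambda}A_i$ with $X\setminus A_i\in\bigcup_{\xi'<\xi}\boldsymbol{\Sigma}^0_{\xi'}(X)$. $\mathcal{M}_\xi(X,Y)$ is the set of $f\colon X\to Y$ with $f^{-1}(U)\in\boldsymbol{\Sigma}^0_\xi(X)$ for all open $U$, and $\mathcal{M}_{<\xi}=\bigcup_{\xi'<\xi}\mathcal{M}_{\xi'}$. For a class $\mathcal{F}$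 of functions, $\lambda\text{-}\!\lim\mathcal{F}$ is the set of all pointwise limits $\lim_{\alpha<\lambda}f_\alpha$ (as nets indexed by the ordinal $\lambda$) with $f_\alpha\in\mathcal{F}$. *)

theory Defs
  imports "HOL-Analysis.Analysis"
begin

unbundle cardinal_syntax

section \<open>Ordinals as elements of a well-order\<close>

text \<open>
  A cardinal \<open>\<lambda>\<close> is a cardinal order relation \<open>lam\<close>; the ordinals below \<open>\<lambda>\<close> are the elements of
  \<open>Field lam\<close>, and the ordinals below \<open>\<lambda>\<^sup>+\<close> are the elements of \<open>Field (cardSuc lam)\<close>:
  an element \<open>a\<close> stands for the order type of \<open>underS r a\<close>.
\<close>

definition ozero :: "'a rel \<Rightarrow> 'a" where
  "ozero r = wo_rel.minim r (Field r)"

definition osuc :: "'a rel \<Rightarrow> 'a \<Rightarrow> 'a" where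
  "osuc r a = wo_rel.suc r {a}"

definition oone :: "'a rel \<Rightarrow> 'a" where
  "oone r = osuc r (ozero r)"

definition is_successor :: "'a rel \<Rightarrow> 'a \<Rightarrow> bool" where
  "is_successor r a \<longleftrightarrow> (\<exists>b\<in>Field r. a = osuc r b)"

definition is_limit :: "'a rel \<Rightarrow> 'a \<Rightarrow> bool" where
  "is_limit r a \<longleftrightarrow> a \<in> Field r \<and> a \<noteq> ozero r \<and> \<not> is_successor r a"

definition cofinal_below :: "'a rel \<Rightarrow> 'a \<Rightarrow> 'a set \<Rightarrow> bool" where
  "cofinal_below r a K \<longleftrightarrow> K \<subseteq> underS r a \<and> (\<forall>b\<in>underS r a. \<exists>c\<in>K. (b, c) \<in> r)"

definition has_cofinality :: "'a rel \<Rightarrow> 'a \<Rightarrow> 'l rel \<Rightarrow> bool" where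
  "has_cofinality r a lam \<longleftrightarrow>
     (\<exists>K. cofinal_below r a K \<and> |K| =o lam) \<and> (\<forall>K. cofinal_below r a K \<longrightarrow> lam \<le>o |K| )"

text \<open>
  \<open>2\<^bsup><\<lambda>\<^esup>\<close> is the cardinality of the set of binary sequences of length less than \<open>\<lambda>\<close>.  Each sequence
  is tagged with its length, since the extensional functions on different initial segments overlap.
\<close>

definition two_lt :: "'l rel \<Rightarrow> ('l \<times> ('l \<Rightarrow> bool)) rel" where
  "two_lt lam = |SIGMA a:Field lam. underS lam a \<rightarrow>\<^sub>E (UNIV :: bool set)|"


section \<open>Metrics with values in an ordered field\<close>

definition positive_coinitial :: "'g::linordered_field set \<Rightarrow> bool" where
  "positive_coinitial K \<longleftrightarrow> K \<subseteq> {0<..} \<and> (\<forall>e>0. \<exists>k\<in>K. k \<le> e)"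

definition has_coinitiality :: "'g::linordered_field itself \<Rightarrow> 'l rel \<Rightarrow> bool" where
  "has_coinitiality G lam \<longleftrightarrow>
     (\<exists>K :: 'g set. positive_coinitial K \<and> |K| =o lam) \<and>
     (\<forall>K :: 'g set. positive_coinitial K \<longrightarrow> lam \<le>o |K| )"

definition G_metric :: "'a set \<Rightarrow> ('a \<Rightarrow> 'a \<Rightarrow> 'g::linordered_field) \<Rightarrow> bool" where
  "G_metric S d \<longleftrightarrow>
     (\<forall>x\<in>S. \<forall>y\<in>S. 0 \<le> d x y \<and> (d x y = 0 \<longleftrightarrow> x = y) \<and> d x y = d y x) \<and>
     (\<forall>x\<in>S. \<forall>y\<in>S. \<forall>z\<in>S. d x z \<le> d x y + d y z)"

definition G_ball :: "'a set \<Rightarrow> ('a \<Rightarrow> 'a \<Rightarrow> 'g::linordered_field) \<Rightarrow> 'a \<Rightarrow> 'g \<Rightarrow> 'a set" where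
  "G_ball S d x r = {y \<in> S. d x y < r}"

definition G_cball :: "'a set \<Rightarrow> ('a \<Rightarrow> 'a \<Rightarrow> 'g::linordered_field) \<Rightarrow> 'a \<Rightarrow> 'g \<Rightarrow> 'a set" where
  "G_cball S d x r = {y \<in> S. d x y \<le> r}"

definition compatible_G_metric :: "'a topology \<Rightarrow> ('a \<Rightarrow> 'a \<Rightarrow> 'g::linordered_field) \<Rightarrow> bool" where
  "compatible_G_metric X d \<longleftrightarrow> G_metric (topspace X) d \<and>
     (\<forall>U. openin X U \<longleftrightarrow>
        U \<subseteq> topspace X \<and> (\<forall>x\<in>U. \<exists>r>0. G_ball (topspace X) d x r \<subseteq> U))"

definition weight_le :: "'a topology \<Rightarrow> 'l rel \<Rightarrow> bool" where
  "weight_le X lam \<longleftrightarrow>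
     (\<exists>\<B>. |\<B>| \<le>o lam \<and> (\<forall>V\<in>\<B>. openin X V) \<and>
          (\<forall>U x. openin X U \<and> x \<in> U \<longrightarrow> (\<exists>V\<in>\<B>. x \<in> V \<and> V \<subseteq> U)))"

definition M_class :: "'g::linordered_field itself \<Rightarrow> 'l rel \<Rightarrow> 'a topology \<Rightarrow> bool" where
  "M_class G lam X \<longleftrightarrow>
     regular_space X \<and> Hausdorff_space X \<and> weight_le X lam \<and>
     (\<exists>d :: 'a \<Rightarrow> 'a \<Rightarrow> 'g. compatible_G_metric X d)"

text \<open>
  The sequences have arbitrary (nonzero) ordinal length.  Indexing them by well-orders on
  \<^typ>\<open>'a set\<close> loses nothing: after deleting repetitions, a decreasing sequence of balls can be
  indexed by its own terms.
\<close>

definition spherically_complete_metric ::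
  "'a set \<Rightarrow> ('a \<Rightarrow> 'a \<Rightarrow> 'g::linordered_field) \<Rightarrow> bool" where
  "spherically_complete_metric S d \<longleftrightarrow>
     (\<forall>(s :: 'a set rel) c r.
        Well_order s \<and> Field s \<noteq> {} \<and> (\<forall>i\<in>Field s. c i \<in> S \<and> 0 < r i) \<and>
        (\<forall>i j. (i, j) \<in> s \<longrightarrow> G_cball S d (c j) (r j) \<subseteq> G_cball S d (c i) (r i))
        \<longrightarrow> (\<Inter>i\<in>Field s. G_cball S d (c i) (r i)) \<noteq> {})"

definition spherically_complete :: "'g::linordered_field itself \<Rightarrow> 'a topology \<Rightarrow> bool" where
  "spherically_complete G Y \<longleftrightarrow>
     (\<exists>d :: 'a \<Rightarrow> 'a \<Rightarrow> 'g. compatible_G_metric Y d \<and> spherically_complete_metric (topspace Y) d)"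


section \<open>The Borel hierarchy, measurable functions and pointwise limits\<close>

inductive Sigma0 :: "'l rel \<Rightarrow> 'a topology \<Rightarrow> 'l set \<Rightarrow> 'a set \<Rightarrow> bool"
  for lam :: "'l rel" and X :: "'a topology" where
  Sigma0_open: "openin X U \<Longrightarrow> Sigma0 lam X (oone (cardSuc lam)) U"
| Sigma0_union:
    "\<lbrakk>oone (cardSuc lam) \<in> underS (cardSuc lam) xi;
      \<forall>i\<in>Field lam. A i \<subseteq> topspace X \<and>
        (\<exists>eta\<in>underS (cardSuc lam) xi. Sigma0 lam X eta (topspace X - A i))\<rbrakk>
     \<Longrightarrow> Sigma0 lam X xi (\<Union>i\<in>Field lam. A i)"

text \<open>Functions between the carriers are represented extensionally.\<close>

definition meas_fun :: "'l rel \<Rightarrow> 'a topology \<Rightarrow> 'b topology \<Rightarrow> 'l set \<Rightarrow> ('a \<Rightarrow> 'b) set" where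
  "meas_fun lam X Y xi =
     {f \<in> topspace X \<rightarrow>\<^sub>E topspace Y.
        \<forall>U. openin Y U \<longrightarrow> Sigma0 lam X xi {x \<in> topspace X. f x \<in> U}}"

definition meas_fun_lt :: "'l rel \<Rightarrow> 'a topology \<Rightarrow> 'b topology \<Rightarrow> 'l set \<Rightarrow> ('a \<Rightarrow> 'b) set" where
  "meas_fun_lt lam X Y xi =
     (\<Union>eta\<in>{eta \<in> underS (cardSuc lam) xi. (oone (cardSuc lam), eta) \<in> cardSuc lam}.
        meas_fun lam X Y eta)"

definition tails :: "'l rel \<Rightarrow> 'l filter" where
  "tails lam = (INF a\<in>Field lam. principal {b \<in> Field lam. (a, b) \<in> lam})"

definition lam_lim ::
  "'l rel \<Rightarrow> 'a topology \<Rightarrow> 'b topology \<Rightarrow> ('a \<Rightarrow> 'b) set \<Rightarrow> ('a \<Rightarrow> 'b) set" where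
  "lam_lim lam X Y F =
     {f \<in> topspace X \<rightarrow>\<^sub>E topspace Y.
        \<exists>g. (\<forall>a\<in>Field lam. g a \<in> F) \<and>
            (\<forall>x\<in>topspace X. limitin Y (\<lambda>a. g a x) (f x) (tails lam))}"

end

theory Submission
  imports Defs
begin

text \<open>
  One inclusion writes \<open>f\<^sup>-\<^sup>1(C) = (\<Union>a. \<Inter>b\<ge>a. f\<^sub>b\<^sup>-\<^sup>1(C))\<close> for clopen \<open>C\<close>, using that \<open>Y\<close> has a base of
  clopen sets.

  For the other one, fix clopen partitions of \<open>Y\<close> at scales \<open>a < \<lambda>\<close>, refining as \<open>a\<close> grows. If \<open>f\<close> is
  \<open>\<Sigma>\<^sup>0\<^sub>\<xi>\<^sub>+\<^sub>1\<close>-measurable, then at scale \<open>a\<close> the space \<open>X\<close> is covered by sets \<open>\<Inter>j<\<lambda>. D a c j\<close>, \<open>c < \<lambda>\<close>, each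
  mapped by \<open>f\<close> into one cell, where the \<open>D a c j\<close> are \<open>\<Delta>\<^sup>0\<close> sets of successor level at most \<open>\<xi>\<close>.
  The value \<open>f\<^sub>b(x)\<close> depends only on which \<open>D a c j\<close> with \<open>a, c, j < b\<close> contain \<open>x\<close>: at each scale
  \<open>a < b\<close> guess the cell belonging to the least \<open>c < b\<close> not refuted by some \<open>j < b\<close>, and choose a
  point in all cells of the longest coherent run of guesses, which exists by spherical
  completeness. Since \<open>2\<^bsup><\<lambda>\<^esup> = \<lambda>\<close>, there are at most \<open>\<lambda>\<close> membership patterns, so \<open>f\<^sub>b\<close> is measurable at
  the common level of these fewer than \<open>\<lambda>\<close> sets; the hypothesis on \<open>\<xi>\<close> puts this level at \<open>\<xi>\<close> or, for
  limit \<open>\<xi>\<close>, below it. By regularity all guesses up to a given scale are correct for large \<open>b\<close>.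
\<close>

subsection \<open>Well-orders\<close>

context wo_rel
begin

lemma not_le_iff_less:
  assumes "a \<in> Field r" "b \<in> Field r"
  shows "(a, b) \<notin> r \<longleftrightarrow> b \<in> underS a"
  using assms TOTALS ANTISYM REFL
  unfolding Order_Relation.underS_def by (auto simp: antisym_def refl_on_def)

lemma under_underS_trans: "(a, b) \<in> r \<Longrightarrow> b \<in> underS c \<Longrightarrow> a \<in> underS c"
  using TRANS ANTISYM unfolding Order_Relation.underS_def by (auto dest: transD antisymD)

lemma underS_under_trans: "a \<in> underS b \<Longrightarrow> (b, c) \<in> r \<Longrightarrow> a \<in> underS c"
  using underS_incr[OF TRANS ANTISYM] by blast

lemma underS_imp_le: "a \<in> underS b \<Longrightarrow> (a, b) \<in> r"
  by (simp add: Order_Relation.underS_def)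

end

locale limit_well_order = wo_rel r for r :: "'a rel" +
  assumes Field_not_empty: "Field r \<noteq> {}"
    and ex_greater: "\<And>a. a \<in> Field r \<Longrightarrow> \<exists>b\<in>Field r. a \<noteq> b \<and> (a, b) \<in> r"
begin

lemma AboveS_singleton_not_empty: "a \<in> Field r \<Longrightarrow> AboveS {a} \<noteq> {}"
  using ex_greater[of a] by (auto simp: AboveS_def)

lemma osuc_in_Field: "a \<in> Field r \<Longrightarrow> osuc r a \<in> Field r"
  unfolding osuc_def by (intro suc_inField AboveS_singleton_not_empty) auto

lemma less_osuc: "a \<in> Field r \<Longrightarrow> a \<in> underS (osuc r a)"
  unfolding osuc_def underS_def
  using suc_greater[OF _ AboveS_singleton_not_empty, of a a] by auto

lemma osuc_le: "a \<in> underS b \<Longrightarrow> (osuc r a, b) \<in> r"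
  unfolding osuc_def
  by (intro suc_least_AboveS) (auto simp: AboveS_def underS_def Field_def)

lemma less_osuc_iff:
  assumes "a \<in> Field r"
  shows "b \<in> underS (osuc r a) \<longleftrightarrow> (b, a) \<in> r"
proof
  assume b: "b \<in> underS (osuc r a)"
  show "(b, a) \<in> r"
  proof (rule ccontr)
    assume "(b, a) \<notin> r"
    then have "a \<in> underS b" using b assms not_le_iff_less underS_Field by fast
    then show False using b osuc_le under_underS_trans underS_notIn by fast
  qed
qed (rule under_underS_trans[OF _ less_osuc[OF assms]])

lemma ozero_in_Field: "ozero r \<in> Field r"
  unfolding ozero_def using minim_inField[OF subset_refl Field_not_empty] .

lemma ozero_le: "b \<in> Field r \<Longrightarrow> (ozero r, b) \<in> r"
  unfolding ozero_def by (rule minim_least) auto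

lemma oone_in_Field: "oone r \<in> Field r"
  unfolding oone_def by (intro osuc_in_Field ozero_in_Field)

lemma oone_le_iff:
  assumes "b \<in> Field r"
  shows "(oone r, b) \<in> r \<longleftrightarrow> b \<noteq> ozero r"
proof
  assume "(oone r, b) \<in> r"
  then have "ozero r \<in> underS b"
    unfolding oone_def using underS_under_trans less_osuc[OF ozero_in_Field] by blast
  then show "b \<noteq> ozero r" using underS_notIn by fast
next
  assume "b \<noteq> ozero r"
  then show "(oone r, b) \<in> r"
    unfolding oone_def using ozero_le[OF assms] by (intro osuc_le) (auto simp: underS_def)
qed

lemma is_successor_in_Field: "is_successor r a \<Longrightarrow> a \<in> Field r"
  unfolding is_successor_def using osuc_in_Field by blast

lemma is_successor_osuc: "a \<in> Field r \<Longrightarrow> is_successor r (osuc r a)"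
  unfolding is_successor_def by blast

lemma is_successor_oone: "is_successor r (oone r)"
  unfolding oone_def by (rule is_successor_osuc[OF ozero_in_Field])

lemma oone_le_is_successor:
  assumes "is_successor r a"
  shows "(oone r, a) \<in> r"
proof -
  obtain b where b: "b \<in> Field r" "a = osuc r b" using assms unfolding is_successor_def by blast
  then have "ozero r \<in> underS a" using less_osuc_iff ozero_le by blast
  then show ?thesis unfolding oone_def by (rule osuc_le)
qed

end

definition superset_order :: "'a set set \<Rightarrow> 'a set rel" where
  "superset_order \<Q> = {(Q, R). Q \<in> \<Q> \<and> R \<in> \<Q> \<and> R \<subseteq> Q}"

lemma Field_superset_order: "Field (superset_order \<Q>) = \<Q>"
  by (auto simp: superset_order_def Field_def)

lemma Well_order_superset_order_iff:
  "Well_order (superset_order \<Q>) \<longleftrightarrow>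
    (\<forall>\<A>\<subseteq>\<Q>. \<A> \<noteq> {} \<longrightarrow> (\<exists>M\<in>\<A>. \<forall>R\<in>\<A>. R \<subseteq> M))" (is "_ \<longleftrightarrow> ?maxima")
proof
  assume "Well_order (superset_order \<Q>)"
  then interpret wo_rel "superset_order \<Q>" by (simp add: wo_rel_def)
  show ?maxima
  proof (intro allI impI)
    fix \<A> assume "\<A> \<subseteq> \<Q>" "\<A> \<noteq> {}"
    then have \<A>: "\<A> \<subseteq> Field (superset_order \<Q>)" "\<A> \<noteq> {}" by (simp_all add: Field_superset_order)
    have "R \<subseteq> minim \<A>" if "R \<in> \<A>" for R
      using minim_least[OF \<A>(1) that] by (simp add: superset_order_def)
    then show "\<exists>M\<in>\<A>. \<forall>R\<in>\<A>. R \<subseteq> M" using minim_in[OF \<A>] by blast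
  qed
next
  assume max: ?maxima
  have "Q \<subseteq> R \<or> R \<subseteq> Q" if "Q \<in> \<Q>" "R \<in> \<Q>" for Q R
    using max[rule_format, of "{Q, R}"] that by auto
  then have lin: "Linear_order (superset_order \<Q>)"
    unfolding order_on_defs Field_superset_order
    by (auto simp: superset_order_def refl_on_def trans_def antisym_def total_on_def)
  show "Well_order (superset_order \<Q>)"
  proof (subst Linear_order_Well_order_iff[OF lin], intro allI impI)
    fix \<A> assume "\<A> \<subseteq> Field (superset_order \<Q>)" "\<A> \<noteq> {}"
    then have \<A>: "\<A> \<subseteq> \<Q>" "\<A> \<noteq> {}" by (simp_all add: Field_superset_order)
    then obtain M where "M \<in> \<A>" "\<forall>R\<in>\<A>. R \<subseteq> M" using max by meson
    then show "\<exists>M\<in>\<A>. \<forall>R\<in>\<A>. (M, R) \<in> superset_order \<Q>"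
      using \<A>(1) by (intro bexI[of _ M]) (auto simp: superset_order_def)
  qed
qed

lemma Well_order_superset_order_image:
  assumes r: "Well_order r" and T: "T \<subseteq> Field r"
    and anti: "\<And>a b. a \<in> T \<Longrightarrow> b \<in> T \<Longrightarrow> (a, b) \<in> r \<Longrightarrow> P b \<subseteq> P a"
  shows "Well_order (superset_order (P ` T))"
  unfolding Well_order_superset_order_iff
proof (intro allI impI)
  fix \<A> assume \<A>: "\<A> \<subseteq> P ` T" "\<A> \<noteq> {}"
  interpret wo_rel r using r by (simp add: wo_rel_def)
  define I where "I = {a \<in> T. P a \<in> \<A>}"
  have I: "I \<subseteq> Field r" "I \<noteq> {}" using \<A> T unfolding I_def by blast+
  have min: "minim I \<in> T" "P (minim I) \<in> \<A>" using minim_in[OF I] unfolding I_def by auto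
  have "R \<subseteq> P (minim I)" if R: "R \<in> \<A>" for R
  proof -
    obtain a where a: "a \<in> T" "R = P a" using R \<A>(1) by blast
    then have "(minim I, a) \<in> r" using minim_least[OF I(1)] R unfolding I_def by blast
    then show ?thesis using anti[OF min(1) a(1)] a(2) by simp
  qed
  then show "\<exists>M\<in>\<A>. \<forall>R\<in>\<A>. R \<subseteq> M" using min(2) by blast
qed

subsection \<open>Regular cardinals\<close>

locale infinite_cardinal =
  fixes lam :: "'l rel"
  assumes card_order: "Card_order lam"
    and infinite_Field: "infinite (Field lam)"
begin

abbreviation small :: "'b set \<Rightarrow> bool" where
  "small A \<equiv> |A| <o lam"

abbreviation moderate :: "'b set \<Rightarrow> bool" where
  "moderate A \<equiv> |A| \<le>o lam"

abbreviation level_le :: "'l set \<Rightarrow> 'l set \<Rightarrow> bool" (infix \<open>\<sqsubseteq>\<close> 50) where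
  "xi \<sqsubseteq> eta \<equiv> (xi, eta) \<in> cardSuc lam"

abbreviation level_less :: "'l set \<Rightarrow> 'l set \<Rightarrow> bool" (infix \<open>\<sqsubset>\<close> 50) where
  "xi \<sqsubset> eta \<equiv> xi \<in> underS (cardSuc lam) eta"

abbreviation level_one :: "'l set" where
  "level_one \<equiv> oone (cardSuc lam)"

abbreviation level_suc :: "'l set \<Rightarrow> 'l set" where
  "level_suc \<equiv> osuc (cardSuc lam)"

lemma Cinfinite: "Cinfinite lam"
  using infinite_Field card_order by (simp add: cinfinite_def)

sublocale lam: limit_well_order lam
proof
  show "Well_order lam" using card_order by (simp add: card_order_on_def)
  show "Field lam \<noteq> {}" using infinite_Field by auto
  show "\<exists>b\<in>Field lam. a \<noteq> b \<and> (a, b) \<in> lam" if "a \<in> Field lam" for a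
    using infinite_Card_order_limit[OF card_order infinite_Field that] .
qed

sublocale level: limit_well_order "cardSuc lam"
proof
  have Cinfinite_Suc: "Cinfinite (cardSuc lam)" using Cinfinite_cardSuc[OF Cinfinite] .
  show "Well_order (cardSuc lam)" using cardSuc_Well_order[OF card_order] .
  show "Field (cardSuc lam) \<noteq> {}" using Cinfinite_Suc by (auto simp: cinfinite_def)
  show "\<exists>b\<in>Field (cardSuc lam). a \<noteq> b \<and> (a, b) \<in> cardSuc lam"
    if "a \<in> Field (cardSuc lam)" for a
    using infinite_Card_order_limit[of "cardSuc lam"] Cinfinite_Suc that
    by (auto simp: cinfinite_def)
qed

lemma moderate_Field: "moderate (Field lam)"
  using card_of_Field_ordIso[OF card_order] ordIso_imp_ordLeq by blast

lemma small_imp_moderate: "small A \<Longrightarrow> moderate A"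
  by (rule ordLess_imp_ordLeq)

lemma moderate_subset: "A \<subseteq> B \<Longrightarrow> moderate B \<Longrightarrow> moderate A"
  using card_of_mono1 ordLeq_transitive by blast

lemma small_subset: "A \<subseteq> B \<Longrightarrow> small B \<Longrightarrow> small A"
  using card_of_mono1 ordLeq_ordLess_trans by blast

lemma moderate_image: "moderate A \<Longrightarrow> moderate (f ` A)"
  using card_of_image ordLeq_transitive by blast

lemma small_image: "small A \<Longrightarrow> small (f ` A)"
  using card_of_image ordLeq_ordLess_trans by blast

lemma small_finite: "finite A \<Longrightarrow> small A"
  using finite_ordLess_infinite[OF card_of_Well_order lam.WELL] infinite_Field
  by (simp add: Field_card_of)

lemma small_underS: "a \<in> Field lam \<Longrightarrow> small (underS lam a)"
  using card_of_underS[OF card_order] .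

lemma under_subset_underS_osuc: "a \<in> Field lam \<Longrightarrow> under lam a \<subseteq> underS lam (osuc lam a)"
  using lam.less_osuc_iff by (auto simp: under_def)

lemma small_under: "a \<in> Field lam \<Longrightarrow> small (under lam a)"
  using small_subset[OF under_subset_underS_osuc] small_underS lam.osuc_in_Field by blast

lemma moderate_UN: "moderate I \<Longrightarrow> (\<And>i. i \<in> I \<Longrightarrow> moderate (A i)) \<Longrightarrow> moderate (\<Union>i\<in>I. A i)"
  using UNION_Cinfinite_bound[OF _ _ Cinfinite] by blast

lemma moderate_insert: "moderate A \<Longrightarrow> moderate (insert x A)"
  using Un_Cinfinite_bound[OF small_imp_moderate[OF small_finite] _ Cinfinite, of "{x}" A] by simp

lemma moderate_enum:
  assumes "moderate A" "A \<noteq> {}"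
  obtains e where "\<And>i. e i \<in> A" "e ` Field lam = A"
proof -
  have "|A| \<le>o |Field lam|"
    using assms(1) card_of_Field_ordIso[OF card_order] ordIso_symmetric ordLeq_ordIso_trans by blast
  then obtain g where g: "g ` Field lam = A"
    using card_of_ordLeq2[OF assms(2), of "Field lam"] by auto
  show ?thesis
  proof
    show "g (if i \<in> Field lam then i else ozero lam) \<in> A" for i
      using g lam.ozero_in_Field by auto
    show "(\<lambda>i. g (if i \<in> Field lam then i else ozero lam)) ` Field lam = A"
      using g by auto
  qed
qed

lemma moderate_enum_Union:
  assumes "moderate \<F>"
  obtains e where "\<And>i. e i \<in> insert {} \<F>" "(\<Union>i\<in>Field lam. e i) = \<Union>\<F>"
proof -
  obtain e where "\<And>i. e i \<in> insert {} \<F>" "e ` Field lam = insert {} \<F>"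
    using moderate_enum[OF moderate_insert[OF assms] insert_not_empty] by metis
  then show ?thesis using that[of e] by simp
qed

lemma eventually_tails:
  "eventually P (tails lam) \<longleftrightarrow> (\<exists>a\<in>Field lam. \<forall>b. (a, b) \<in> lam \<longrightarrow> P b)"
proof -
  have "eventually P (tails lam) \<longleftrightarrow>
    (\<exists>a\<in>Field lam. eventually P (principal {b \<in> Field lam. (a, b) \<in> lam}))"
    unfolding tails_def
  proof (rule eventually_INF_base[OF lam.Field_not_empty])
    fix a b assume "a \<in> Field lam" "b \<in> Field lam"
    then obtain c where "c \<in> Field lam" "(a, c) \<in> lam" "(b, c) \<in> lam"
      using lam.TOTALS lam.REFL by (metis refl_onD)
    then show "\<exists>x\<in>Field lam. principal {b \<in> Field lam. (x, b) \<in> lam}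
        \<le> inf (principal {b \<in> Field lam. (a, b) \<in> lam}) (principal {c \<in> Field lam. (b, c) \<in> lam})"
      using lam.TRANS by (intro bexI[of _ c]) (auto dest: transD)
  qed
  then show ?thesis by (auto simp: eventually_principal Field_def)
qed

lemma tails_nontrivial: "tails lam \<noteq> bot"
  using lam.REFL unfolding trivial_limit_def eventually_tails by (auto dest: refl_onD)

lemma eventually_tails_greater:
  assumes "a \<in> Field lam"
  shows "eventually (\<lambda>b. a \<in> underS lam b) (tails lam)"
  unfolding eventually_tails
  using lam.osuc_in_Field[OF assms] lam.underS_under_trans[OF lam.less_osuc[OF assms]] by blast

definition successor_levels :: "'l set \<Rightarrow> 'l set set" where
  "successor_levels xi = {zeta. is_successor (cardSuc lam) zeta \<and> zeta \<sqsubseteq> xi}"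

lemma level_one_in_successor_levels: "level_one \<sqsubseteq> xi \<Longrightarrow> level_one \<in> successor_levels xi"
  by (simp add: successor_levels_def level.is_successor_oone)

lemma level_suc_in_successor_levels: "eta \<sqsubset> xi \<Longrightarrow> level_suc eta \<in> successor_levels xi"
  by (simp add: successor_levels_def level.osuc_le level.is_successor_osuc underS_Field)

lemma successor_levels_less:
  "\<not> is_successor (cardSuc lam) xi \<Longrightarrow> zeta \<in> successor_levels xi \<Longrightarrow> zeta \<sqsubset> xi"
  by (auto simp: successor_levels_def underS_def)

definition admissible_level :: "'l set \<Rightarrow> bool" where
  "admissible_level xi \<longleftrightarrow> is_successor (cardSuc lam) xi \<or>
    (is_limit (cardSuc lam) xi \<and> has_cofinality (cardSuc lam) xi lam)"

lemma successor_levels_directed: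
  assumes xi: "admissible_level xi"
    and J: "small J" "J \<subseteq> successor_levels xi"
  shows "\<exists>zeta\<in>successor_levels xi. \<forall>eta\<in>J. eta \<sqsubseteq> zeta"
proof (cases "is_successor (cardSuc lam) xi")
  case True
  then have "xi \<in> successor_levels xi"
    using level.is_successor_in_Field level.REFL by (auto simp: successor_levels_def dest: refl_onD)
  then show ?thesis using J(2) unfolding successor_levels_def by blast
next
  case False
  have less: "eta \<sqsubset> xi" if "eta \<in> J" for eta
    using successor_levels_less[OF False] J(2) that by blast
  moreover have "\<not> cofinal_below (cardSuc lam) xi J"
    using xi False J(1) not_ordLess_ordLeq
    unfolding admissible_level_def has_cofinality_def by blast
  ultimately obtain b where b: "b \<sqsubset> xi" "\<And>eta. eta \<in> J \<Longrightarrow> \<not> b \<sqsubseteq> eta"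
    unfolding cofinal_below_def by blast
  have "eta \<sqsubseteq> level_suc b" if eta: "eta \<in> J" for eta
  proof -
    have "b \<in> Field (cardSuc lam)" "eta \<in> Field (cardSuc lam)"
      using b(1) less[OF eta] underS_Field by fast+
    then have "eta \<sqsubset> b" "b \<sqsubset> level_suc b"
      using b(2)[OF eta] level.not_le_iff_less level.less_osuc by blast+
    then show ?thesis
      using level.underS_imp_le level.underS_under_trans by metis
  qed
  then show ?thesis using level_suc_in_successor_levels[OF b(1)] by blast
qed

end

locale regular_cardinal = infinite_cardinal lam for lam :: "'l rel" +
  assumes regular: "regularCard lam"
begin

lemma stable: "stable lam"
  using regularCard_stable[OF card_order infinite_Field regular] .

lemma small_Sigma: "small I \<Longrightarrow> (\<And>i. i \<in> I \<Longrightarrow> small (A i)) \<Longrightarrow> small (SIGMA i:I. A i)"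
  using stable_elim[OF stable] by blast

lemma small_UN: "small I \<Longrightarrow> (\<And>i. i \<in> I \<Longrightarrow> small (A i)) \<Longrightarrow> small (\<Union>i\<in>I. A i)"
  using stable_UNION[OF stable] by blast

lemma small_bounded:
  assumes "A \<subseteq> Field lam" "small A"
  obtains b where "b \<in> Field lam" "A \<subseteq> underS lam b"
proof -
  have "\<not> cofinal A lam"
    using assms regular not_ordLess_ordIso unfolding regularCard_def by blast
  then obtain a where a: "a \<in> Field lam" "\<And>b. b \<in> A \<Longrightarrow> a = b \<or> (a, b) \<notin> lam"
    unfolding cofinal_def by blast
  have "A \<subseteq> under lam a"
  proof
    fix b assume b: "b \<in> A"
    then show "b \<in> under lam a"
      using a(2)[OF b] assms(1) a(1) lam.TOTALS lam.REFL
      by (auto simp: under_def refl_on_def)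
  qed
  then show ?thesis
    using that[OF lam.osuc_in_Field[OF a(1)]] under_subset_underS_osuc[OF a(1)] by blast
qed

lemma eventually_tails_small_ball:
  assumes "small A" "\<And>a. a \<in> A \<Longrightarrow> eventually (P a) (tails lam)"
  shows "eventually (\<lambda>b. \<forall>a\<in>A. P a b) (tails lam)"
proof -
  obtain w where w: "\<And>a. a \<in> A \<Longrightarrow> w a \<in> Field lam"
    "\<And>a b. a \<in> A \<Longrightarrow> (w a, b) \<in> lam \<Longrightarrow> P a b"
    using assms(2) unfolding eventually_tails by metis
  obtain c where "c \<in> Field lam" "w ` A \<subseteq> underS lam c"
    using small_bounded[OF image_subsetI small_image[OF assms(1)], of w] w(1) by metis
  moreover have "(w a, b) \<in> lam" if "a \<in> A" "(c, b) \<in> lam" for a b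
    using that \<open>w ` A \<subseteq> underS lam c\<close> lam.underS_under_trans lam.underS_imp_le by blast
  ultimately show ?thesis unfolding eventually_tails using w(2) by blast
qed

end

locale two_lt_cardinal = regular_cardinal lam for lam :: "'l rel" +
  assumes two_lt: "two_lt lam =o lam"
begin

lemma moderate_Pow:
  assumes "small I"
  shows "moderate (Pow I)"
proof -
  have "|I| \<le>o |Field lam|"
    using small_imp_moderate[OF assms] card_of_Field_ordIso[OF card_order]
      ordIso_symmetric ordLeq_ordIso_trans by blast
  then obtain h where h: "inj_on h I" "h ` I \<subseteq> Field lam"
    using card_of_ordLeq[of I "Field lam"] by auto
  then obtain a where a: "a \<in> Field lam" "h ` I \<subseteq> underS lam a"
    using small_bounded[OF _ small_image[OF assms]] by metis
  define code where "code J = (a, \<lambda>b\<in>underS lam a. b \<in> h ` J)" for J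
  have "inj_on code (Pow I)"
  proof (rule inj_onI)
    fix J K assume JK: "J \<in> Pow I" "K \<in> Pow I" "code J = code K"
    have "b \<in> h ` J \<longleftrightarrow> b \<in> h ` K" if "b \<in> underS lam a" for b
      using fun_cong[OF arg_cong[OF JK(3), of snd], of b] that by (simp add: code_def)
    then have "h ` J = h ` K" using JK(1,2) a(2) by blast
    then show "J = K" using inj_on_image_eq_iff[OF h(1)] JK(1,2) by blast
  qed
  moreover have "code ` Pow I \<subseteq> (SIGMA a:Field lam. underS lam a \<rightarrow>\<^sub>E (UNIV :: bool set))"
    using a(1) by (auto simp: code_def)
  ultimately have "|Pow I| \<le>o two_lt lam"
    unfolding two_lt_def using card_of_ordLeq by blast
  then show ?thesis using two_lt ordLeq_ordIso_trans by blast
qed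

text \<open>
  For distributing a small intersection of unions: by regularity the indices chosen at a given point
  are bounded, so relations with a bounded range suffice, of which there are only \<open>\<lambda>\<close>.
\<close>

definition small_choices :: "'j set \<Rightarrow> ('j \<times> 'l) set set" where
  "small_choices J = {S \<in> (\<Union>c\<in>Field lam. Pow (J \<times> underS lam c)). J \<subseteq> Domain S}"

lemma moderate_small_choices: "small J \<Longrightarrow> moderate (small_choices J)"
  by (rule moderate_subset[of _ "\<Union>c\<in>Field lam. Pow (J \<times> underS lam c)"])
    (auto simp: small_choices_def
      intro!: moderate_UN moderate_Field moderate_Pow small_Sigma small_underS)

lemma small_in_small_choices:
  assumes "small J" "S \<in> small_choices J"
  shows "small S"
proof -
  obtain c where c: "c \<in> Field lam" "S \<subseteq> J \<times> underS lam c"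
    using assms(2) unfolding small_choices_def by blast
  then show ?thesis using small_subset small_Sigma[OF assms(1)] small_underS by metis
qed

lemma small_INT_UN_distrib:
  assumes "small J"
  shows "(\<Inter>j\<in>J. \<Union>i\<in>Field lam. A j i) = (\<Union>S\<in>small_choices J. \<Inter>(j, i)\<in>S. A j i)"
proof (intro equalityI subsetI)
  fix x assume "x \<in> (\<Inter>j\<in>J. \<Union>i\<in>Field lam. A j i)"
  then have "\<forall>j\<in>J. \<exists>i\<in>Field lam. x \<in> A j i" by blast
  then obtain s where s: "\<And>j. j \<in> J \<Longrightarrow> s j \<in> Field lam \<and> x \<in> A j (s j)" by metis
  obtain c where "c \<in> Field lam" "s ` J \<subseteq> underS lam c"
    using small_bounded[OF image_subsetI small_image[OF assms], of s] s by metis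
  then have "(\<lambda>j. (j, s j)) ` J \<in> small_choices J"
    unfolding small_choices_def by blast
  then show "x \<in> (\<Union>S\<in>small_choices J. \<Inter>(j, i)\<in>S. A j i)" using s by blast
next
  fix x assume "x \<in> (\<Union>S\<in>small_choices J. \<Inter>(j, i)\<in>S. A j i)"
  then obtain S where S: "S \<in> small_choices J" "\<And>j i. (j, i) \<in> S \<Longrightarrow> x \<in> A j i" by blast
  obtain c where c: "S \<subseteq> J \<times> underS lam c" "J \<subseteq> Domain S"
    using S(1) unfolding small_choices_def by blast
  have "\<exists>i\<in>Field lam. (j, i) \<in> S" if j: "j \<in> J" for j
  proof -
    obtain i where "(j, i) \<in> S" using c(2) j by blast
    then show ?thesis using c(1) underS_Field[of i lam c] by blast
  qed
  then show "x \<in> (\<Inter>j\<in>J. \<Union>i\<in>Field lam. A j i)" using S(2) by blast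
qed

end

subsection \<open>The Borel hierarchy of a zero-dimensional space\<close>

definition clopenin :: "'a topology \<Rightarrow> 'a set \<Rightarrow> bool" where
  "clopenin X C \<longleftrightarrow> openin X C \<and> closedin X C"

locale zero_dim_space = infinite_cardinal lam for lam :: "'l rel" +
  fixes X :: "'a topology"
  assumes weight: "weight_le X lam"
    and ex_clopenin: "openin X U \<Longrightarrow> x \<in> U \<Longrightarrow> \<exists>C. clopenin X C \<and> x \<in> C \<and> C \<subseteq> U"
begin

lemma Lindelof:
  assumes "\<And>U. U \<in> \<U> \<Longrightarrow> openin X U"
  obtains \<V> where "\<V> \<subseteq> \<U>" "moderate \<V>" "\<Union>\<V> = \<Union>\<U>"
proof -
  obtain \<B> where \<B>: "moderate \<B>"
    "\<forall>U x. openin X U \<and> x \<in> U \<longrightarrow> (\<exists>V\<in>\<B>. x \<in> V \<and> V \<subseteq> U)"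
    using weight unfolding weight_le_def by (elim exE conjE) (rule that)
  define \<C> where "\<C> = {V \<in> \<B>. \<exists>U\<in>\<U>. V \<subseteq> U}"
  have "\<forall>V\<in>\<C>. \<exists>U. U \<in> \<U> \<and> V \<subseteq> U" unfolding \<C>_def by blast
  then obtain u where u: "\<And>V. V \<in> \<C> \<Longrightarrow> u V \<in> \<U> \<and> V \<subseteq> u V" by metis
  show ?thesis
  proof
    show sub: "u ` \<C> \<subseteq> \<U>" using u by blast
    show "moderate (u ` \<C>)"
      by (rule moderate_image, rule moderate_subset[OF _ \<B>(1)]) (auto simp: \<C>_def)
    have "x \<in> \<Union>(u ` \<C>)" if xU: "x \<in> U" "U \<in> \<U>" for x U
    proof -
      obtain V where "V \<in> \<B>" "x \<in> V" "V \<subseteq> U" using \<B>(2) assms[OF xU(2)] xU(1) by blast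
      then show ?thesis using u[of V] xU unfolding \<C>_def by blast
    qed
    then show "\<Union>(u ` \<C>) = \<Union>\<U>" using sub by blast
  qed
qed

lemma openin_Union_clopenin:
  assumes "openin X U"
  obtains \<C> where "moderate \<C>" "\<And>C. C \<in> \<C> \<Longrightarrow> clopenin X C" "\<Union>\<C> = U"
proof -
  obtain \<C> where "\<C> \<subseteq> {C. clopenin X C \<and> C \<subseteq> U}" "moderate \<C>"
    "\<Union>\<C> = \<Union>{C. clopenin X C \<and> C \<subseteq> U}"
    using Lindelof[of "{C. clopenin X C \<and> C \<subseteq> U}"] by (auto simp: clopenin_def)
  moreover have "\<Union>{C. clopenin X C \<and> C \<subseteq> U} = U"
    using ex_clopenin[OF assms] by blast
  ultimately show ?thesis using that[of \<C>] by auto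
qed

abbreviation Sig :: "'l set \<Rightarrow> 'a set \<Rightarrow> bool" where
  "Sig \<equiv> Sigma0 lam X"

definition Pi0 :: "'l set \<Rightarrow> 'a set \<Rightarrow> bool" where
  "Pi0 xi A \<longleftrightarrow> A \<subseteq> topspace X \<and> Sig xi (topspace X - A)"

definition Delta0 :: "'l set \<Rightarrow> 'a set \<Rightarrow> bool" where
  "Delta0 xi A \<longleftrightarrow> Sig xi A \<and> Pi0 xi A"

lemma Sigma0_level: "Sig xi U \<Longrightarrow> level_one \<sqsubseteq> xi"
  by (induction rule: Sigma0.induct)
    (use level.oone_in_Field level.REFL level.underS_imp_le in \<open>auto dest: refl_onD\<close>)

lemma Pi0_level: "Pi0 xi A \<Longrightarrow> level_one \<sqsubseteq> xi"
  unfolding Pi0_def using Sigma0_level by blast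

lemma Sigma0_one: "Sig level_one U \<longleftrightarrow> openin X U"
proof
  assume "Sig level_one U"
  then show "openin X U" by cases (auto simp: underS_def)
qed (rule Sigma0_open)

lemma Pi0_one: "Pi0 level_one A \<longleftrightarrow> closedin X A"
  by (simp add: Pi0_def Sigma0_one closedin_def)

lemma Sigma0_iff_Union_Pi0:
  assumes "level_one \<sqsubset> xi"
  shows "Sig xi U \<longleftrightarrow>
    (\<exists>\<F>. moderate \<F> \<and> U = \<Union>\<F> \<and> (\<forall>A\<in>\<F>. \<exists>eta. eta \<sqsubset> xi \<and> Pi0 eta A))"
    (is "_ \<longleftrightarrow> (\<exists>\<F>. ?presents \<F>)")
proof
  assume "Sig xi U"
  then show "\<exists>\<F>. ?presents \<F>"
  proof cases
    case Sigma0_open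
    then show ?thesis using assms underS_notIn by fast
  next
    case (Sigma0_union A)
    then have "?presents (A ` Field lam)"
      using moderate_image[OF moderate_Field, of A] unfolding Pi0_def by blast
    then show ?thesis by blast
  qed
next
  assume "\<exists>\<F>. ?presents \<F>"
  then obtain \<F> where \<F>: "moderate \<F>" "U = \<Union>\<F>" "\<And>A. A \<in> \<F> \<Longrightarrow> \<exists>eta. eta \<sqsubset> xi \<and> Pi0 eta A"
    by blast
  obtain e where e: "\<And>i. e i \<in> insert {} \<F>" "(\<Union>i\<in>Field lam. e i) = \<Union>\<F>"
    using moderate_enum_Union[OF \<F>(1)] by blast
  have "Pi0 level_one {}" by (simp add: Pi0_one)
  then have "\<exists>eta. eta \<sqsubset> xi \<and> Pi0 eta (e i)" for i
    using e(1)[of i] \<F>(3) assms by auto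
  then have "Sig xi (\<Union>i\<in>Field lam. e i)"
    unfolding Pi0_def by (intro Sigma0_union[OF assms]) blast
  then show "Sig xi U" using e(2) \<F>(2) by simp
qed

lemma Pi0_imp_Sigma0:
  assumes "Pi0 eta A" "eta \<sqsubset> xi"
  shows "Sig xi A"
proof -
  have "level_one \<sqsubset> xi"
    using level.under_underS_trans[OF Pi0_level[OF assms(1)] assms(2)] .
  moreover have "moderate {A}" by (simp add: small_finite small_imp_moderate)
  ultimately show ?thesis
    using assms by (subst Sigma0_iff_Union_Pi0) (auto intro!: exI[of _ "{A}"])
qed

lemma Sigma0_mono:
  assumes "Sig eta U" "eta \<sqsubseteq> xi"
  shows "Sig xi U"
proof -
  consider (equal) "eta = xi" | (open_set) "eta = level_one" "level_one \<sqsubset> xi"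
    | (beyond_open) "level_one \<sqsubset> eta"
    using Sigma0_level[OF assms(1)] assms(2) by (auto simp: underS_def)
  then show ?thesis
  proof cases
    case equal
    then show ?thesis using assms(1) by simp
  next
    case open_set
    obtain \<C> where \<C>: "moderate \<C>" "\<And>C. C \<in> \<C> \<Longrightarrow> clopenin X C" "\<Union>\<C> = U"
      using assms(1) open_set(1) Sigma0_one openin_Union_clopenin by metis
    then have "\<forall>C\<in>\<C>. Pi0 level_one C" by (simp add: Pi0_one clopenin_def)
    then show ?thesis
      unfolding Sigma0_iff_Union_Pi0[OF open_set(2)] using \<C>(1,3) open_set(2) by blast
  next
    case beyond_open
    have "level_one \<sqsubset> xi" using level.underS_under_trans[OF beyond_open assms(2)] .
    then show ?thesis
      using assms(1) level.underS_under_trans[OF _ assms(2)]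
      unfolding Sigma0_iff_Union_Pi0[OF beyond_open] Sigma0_iff_Union_Pi0[OF \<open>level_one \<sqsubset> xi\<close>]
      by blast
  qed
qed

lemma Pi0_mono: "Pi0 eta A \<Longrightarrow> eta \<sqsubseteq> xi \<Longrightarrow> Pi0 xi A"
  unfolding Pi0_def using Sigma0_mono by blast

lemma Delta0_mono: "Delta0 eta A \<Longrightarrow> eta \<sqsubseteq> xi \<Longrightarrow> Delta0 xi A"
  unfolding Delta0_def using Sigma0_mono Pi0_mono by blast

lemma Delta0_Diff: "Delta0 xi A \<Longrightarrow> Delta0 xi (topspace X - A)"
  unfolding Delta0_def Pi0_def by (simp add: double_diff)

lemma Delta0_empty: "Delta0 level_one {}"
  by (simp add: Delta0_def Sigma0_one Pi0_one)

lemma Sigma0_UN: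
  assumes "moderate I" "\<And>i. i \<in> I \<Longrightarrow> Sig xi (U i)" "level_one \<sqsubseteq> xi"
  shows "Sig xi (\<Union>i\<in>I. U i)"
proof (cases "xi = level_one")
  case True
  then show ?thesis using assms by (auto simp: Sigma0_one)
next
  case False
  then have one_less: "level_one \<sqsubset> xi" using assms(3) by (auto simp: underS_def)
  obtain F where F: "\<And>i. i \<in> I \<Longrightarrow> moderate (F i) \<and> U i = \<Union>(F i) \<and>
    (\<forall>A\<in>F i. \<exists>eta. eta \<sqsubset> xi \<and> Pi0 eta A)"
    using assms(2) unfolding Sigma0_iff_Union_Pi0[OF one_less] by metis
  have "moderate (\<Union>i\<in>I. F i)" using moderate_UN[OF assms(1)] F by blast
  then show ?thesis
    unfolding Sigma0_iff_Union_Pi0[OF one_less] using F by (intro exI[of _ "\<Union>i\<in>I. F i"]) auto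
qed

lemma Pi0_INT:
  assumes "moderate I" "\<And>i. i \<in> I \<Longrightarrow> Pi0 xi (A i)" "level_one \<sqsubseteq> xi"
  shows "Pi0 xi (topspace X \<inter> (\<Inter>i\<in>I. A i))"
proof -
  have "Sig xi (\<Union>i\<in>I. topspace X - A i)"
    using assms by (intro Sigma0_UN) (auto simp: Pi0_def)
  moreover have "(\<Union>i\<in>I. topspace X - A i) = topspace X - topspace X \<inter> (\<Inter>i\<in>I. A i)"
    by blast
  ultimately show ?thesis by (simp add: Pi0_def)
qed

lemma Sigma0_suc_iff:
  assumes "level_one \<sqsubseteq> xi"
  shows "Sig (level_suc xi) U \<longleftrightarrow> (\<exists>\<F>. moderate \<F> \<and> U = \<Union>\<F> \<and> (\<forall>A\<in>\<F>. Pi0 xi A))"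
proof -
  have xi: "xi \<in> Field (cardSuc lam)" using assms by (auto simp: Field_def)
  have "(\<exists>eta. eta \<sqsubset> level_suc xi \<and> Pi0 eta A) \<longleftrightarrow> Pi0 xi A" for A
    using level.less_osuc[OF xi] Pi0_mono unfolding level.less_osuc_iff[OF xi] by blast
  then show ?thesis
    using Sigma0_iff_Union_Pi0[OF level.under_underS_trans[OF assms level.less_osuc[OF xi]]] by simp
qed

lemma Sigma0_suc_enum:
  assumes "Sig (level_suc xi) U" "level_one \<sqsubseteq> xi"
  obtains e where "U = (\<Union>i\<in>Field lam. e i)" "\<And>i. Pi0 xi (e i)"
proof -
  obtain \<F> where \<F>: "moderate \<F>" "U = \<Union>\<F>" "\<forall>A\<in>\<F>. Pi0 xi A"
    using assms(1) unfolding Sigma0_suc_iff[OF assms(2)] by blast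
  have "Pi0 xi {}" using Delta0_mono[OF Delta0_empty assms(2)] by (simp add: Delta0_def)
  then have "\<forall>A\<in>insert {} \<F>. Pi0 xi A" using \<F>(3) by blast
  moreover obtain e where "\<And>i. e i \<in> insert {} \<F>" "(\<Union>i\<in>Field lam. e i) = \<Union>\<F>"
    using moderate_enum_Union[OF \<F>(1)] by blast
  ultimately show ?thesis using that \<F>(2) by metis
qed

lemma Pi0_imp_Delta0_suc:
  assumes "Pi0 eta A"
  shows "Delta0 (level_suc eta) A"
proof -
  have "eta \<in> Field (cardSuc lam)"
    using Pi0_level[OF assms] by (auto simp: Field_def)
  then have eta_less: "eta \<sqsubset> level_suc eta" by (rule level.less_osuc)
  show ?thesis
    unfolding Delta0_def
    using Pi0_imp_Sigma0[OF assms eta_less] Pi0_mono[OF assms level.underS_imp_le[OF eta_less]] ..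
qed

text \<open>
  Only successor levels are admitted because there \<open>\<Sigma>\<^sup>0\<close> is closed under small intersections. When
  \<open>xi\<close> is a limit, they all lie below \<open>xi\<close>.
\<close>

definition Delta0_successor :: "'l set \<Rightarrow> 'a set \<Rightarrow> bool" where
  "Delta0_successor xi A \<longleftrightarrow> (\<exists>zeta\<in>successor_levels xi. Delta0 zeta A)"

lemma Sigma0_Union_Delta0_successor:
  assumes "Sig xi U"
  obtains \<F> where "moderate \<F>" "U = \<Union>\<F>" "\<And>A. A \<in> \<F> \<Longrightarrow> Delta0_successor xi A"
proof (cases "xi = level_one")
  case True
  obtain \<C> where \<C>: "moderate \<C>" "\<And>C. C \<in> \<C> \<Longrightarrow> clopenin X C" "\<Union>\<C> = U"
    using openin_Union_clopenin assms True Sigma0_one by metis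
  have "Delta0_successor xi C" if "C \<in> \<C>" for C
    using \<C>(2)[OF that] level_one_in_successor_levels[OF Sigma0_level[OF assms]]
    unfolding Delta0_successor_def
    by (intro bexI[of _ level_one]) (auto simp: Delta0_def Sigma0_one Pi0_one clopenin_def)
  then show ?thesis using that[of \<C>] \<C>(1,3) by blast
next
  case False
  then have one_less: "level_one \<sqsubset> xi" using Sigma0_level[OF assms] by (auto simp: underS_def)
  obtain \<F> where \<F>: "moderate \<F>" "U = \<Union>\<F>" "\<forall>A\<in>\<F>. \<exists>eta. eta \<sqsubset> xi \<and> Pi0 eta A"
    using assms unfolding Sigma0_iff_Union_Pi0[OF one_less] by blast
  have "Delta0_successor xi A" if "A \<in> \<F>" for A
    using \<F>(3) that Pi0_imp_Delta0_suc level_suc_in_successor_levels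
    unfolding Delta0_successor_def by metis
  then show ?thesis using that \<F>(1,2) by blast
qed

lemma Pi0_INT_Delta0_successor:
  assumes "Pi0 xi A"
  obtains D where "A = topspace X \<inter> (\<Inter>j\<in>Field lam. D j)" "\<And>j. Delta0_successor xi (D j)"
proof -
  have A: "A \<subseteq> topspace X" "Sig xi (topspace X - A)" using assms by (auto simp: Pi0_def)
  obtain \<F> where \<F>: "moderate \<F>" "topspace X - A = \<Union>\<F>"
    "\<And>B. B \<in> \<F> \<Longrightarrow> Delta0_successor xi B"
    using Sigma0_Union_Delta0_successor[OF A(2)] by metis
  obtain e where e: "\<And>i. e i \<in> insert {} \<F>" "(\<Union>i\<in>Field lam. e i) = \<Union>\<F>"
    using moderate_enum_Union[OF \<F>(1)] by blast
  have "Delta0_successor xi {}"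
    unfolding Delta0_successor_def
    using level_one_in_successor_levels[OF Sigma0_level[OF A(2)]] Delta0_empty by blast
  then have "\<forall>B\<in>insert {} \<F>. Delta0_successor xi B" using \<F>(3) by blast
  then have "Delta0_successor xi (e j)" for j using e(1) by blast
  then have "Delta0_successor xi (topspace X - e j)" for j
    unfolding Delta0_successor_def using Delta0_Diff by blast
  moreover have "A = topspace X \<inter> (\<Inter>j\<in>Field lam. topspace X - e j)"
    using A(1) \<F>(2) e(2) by blast
  ultimately show ?thesis by (rule that[rotated])
qed

lemma Delta0_successor_common_level:
  assumes "admissible_level xi"
    and "small I" and "\<And>t. t \<in> I \<Longrightarrow> Delta0_successor xi (D t)"
  obtains zeta where "zeta \<in> successor_levels xi" "\<And>t. t \<in> I \<Longrightarrow> Delta0 zeta (D t)"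
proof -
  obtain z where z: "\<And>t. t \<in> I \<Longrightarrow> z t \<in> successor_levels xi \<and> Delta0 (z t) (D t)"
    using assms(3) unfolding Delta0_successor_def by metis
  then obtain zeta where "zeta \<in> successor_levels xi" "\<forall>eta\<in>z ` I. eta \<sqsubseteq> zeta"
    using successor_levels_directed[OF assms(1) small_image[OF assms(2)], of z] by blast
  then show ?thesis using that[of zeta] z Delta0_mono by blast
qed

lemma meas_fun_mono: "eta \<sqsubseteq> xi \<Longrightarrow> meas_fun lam X Y eta \<subseteq> meas_fun lam X Y xi"
  unfolding meas_fun_def using Sigma0_mono by blast

lemma meas_fun_successor_levels_subset:
  "(\<Union>zeta\<in>successor_levels xi. meas_fun lam X Y zeta) \<subseteq> meas_fun lam X Y xi"
  by (intro UN_least meas_fun_mono) (simp add: successor_levels_def)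

lemma meas_fun_lt_subset: "meas_fun_lt lam X Y xi \<subseteq> meas_fun lam X Y xi"
  unfolding meas_fun_lt_def by (intro UN_least meas_fun_mono) (simp add: level.underS_imp_le)

lemma meas_fun_successor_levels_subset_lt:
  assumes "is_limit (cardSuc lam) xi"
  shows "(\<Union>zeta\<in>successor_levels xi. meas_fun lam X Y zeta) \<subseteq> meas_fun_lt lam X Y xi"
proof -
  have "zeta \<sqsubset> xi \<and> level_one \<sqsubseteq> zeta" if "zeta \<in> successor_levels xi" for zeta
    using that assms successor_levels_less level.oone_le_is_successor
    by (auto simp: is_limit_def successor_levels_def)
  then show ?thesis unfolding meas_fun_lt_def by blast
qed

lemma meas_fun_empty_topspace:
  assumes "topspace X = {}" "level_one \<sqsubseteq> xi"
  shows "meas_fun lam X Y xi = topspace X \<rightarrow>\<^sub>E topspace Y"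
proof -
  have "Sig xi {}" using Sigma0_mono[OF _ assms(2)] Sigma0_one openin_empty by metis
  then show ?thesis unfolding meas_fun_def by (simp add: assms(1))
qed

end

subsection \<open>Small intersections\<close>

locale additive_space = zero_dim_space lam X + two_lt_cardinal lam
  for lam :: "'l rel" and X :: "'a topology" +
  assumes openin_small_Inter:
    "small \<U> \<Longrightarrow> (\<And>U. U \<in> \<U> \<Longrightarrow> openin X U) \<Longrightarrow> openin X (topspace X \<inter> \<Inter>\<U>)"
begin

lemma Sigma0_small_INT:
  assumes "is_successor (cardSuc lam) xi" "small J" "\<And>j. j \<in> J \<Longrightarrow> Sig xi (U j)"
  shows "Sig xi (topspace X \<inter> (\<Inter>j\<in>J. U j))"
proof -
  obtain b where b: "b \<in> Field (cardSuc lam)" "xi = level_suc b"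
    using assms(1) unfolding is_successor_def by blast
  show ?thesis
  proof (cases "b = ozero (cardSuc lam)")
    case True
    then have "xi = level_one" using b by (simp add: oone_def)
    then show ?thesis
      using assms(3) openin_small_Inter[OF small_image[OF assms(2)], of U]
      by (auto simp: Sigma0_one)
  next
    case False
    then have one_le: "level_one \<sqsubseteq> b" using level.oone_le_iff[OF b(1)] by simp
    have "\<exists>e. U j = (\<Union>i\<in>Field lam. e i) \<and> (\<forall>i. Pi0 b (e i))" if "j \<in> J" for j
      using Sigma0_suc_enum[OF _ one_le] assms(3)[OF that] b(2) by metis
    then obtain e where e: "\<And>j. j \<in> J \<Longrightarrow> U j = (\<Union>i\<in>Field lam. e j i)"
      "\<And>j i. j \<in> J \<Longrightarrow> Pi0 b (e j i)" by metis
    define T where "T S = topspace X \<inter> (\<Inter>(j, i)\<in>S. e j i)" for S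
    have "Pi0 b (T S)" if S: "S \<in> small_choices J" for S
    proof -
      have "S \<subseteq> J \<times> UNIV" using S unfolding small_choices_def by blast
      then show ?thesis
        unfolding T_def using small_in_small_choices[OF assms(2) S] e(2) one_le
        by (intro Pi0_INT small_imp_moderate) auto
    qed
    moreover have "topspace X \<inter> (\<Inter>j\<in>J. U j) = \<Union>(T ` small_choices J)"
      using small_INT_UN_distrib[OF assms(2), of e] e(1) by (auto simp: T_def)
    ultimately show ?thesis
      unfolding b(2) Sigma0_suc_iff[OF one_le]
      using moderate_image[OF moderate_small_choices[OF assms(2)], of T] by blast
  qed
qed

lemma Sigma0_membership_pattern:
  assumes "is_successor (cardSuc lam) xi" "small I" "\<And>t. t \<in> I \<Longrightarrow> Delta0 xi (D t)"
  shows "Sig xi {x \<in> topspace X. P {t \<in> I. x \<in> D t}}"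
proof -
  define fib where
    "fib S = topspace X \<inter> (\<Inter>t\<in>I. if t \<in> S then D t else topspace X - D t)" for S
  have fib_iff: "x \<in> fib S \<longleftrightarrow> x \<in> topspace X \<and> {t \<in> I. x \<in> D t} = S" if "S \<subseteq> I" for x S
    using that by (auto simp: fib_def split: if_splits)
  have "Sig xi (fib S)" for S
    unfolding fib_def using assms(3)
    by (intro Sigma0_small_INT[OF assms(1,2)]) (auto simp: Delta0_def Pi0_def)
  moreover have "moderate {S \<in> Pow I. P S}"
    by (rule moderate_subset[OF _ moderate_Pow[OF assms(2)]]) blast
  ultimately have "Sig xi (\<Union>S\<in>{S \<in> Pow I. P S}. fib S)"
    using level.oone_le_is_successor[OF assms(1)] by (intro Sigma0_UN)
  moreover have "(\<Union>S\<in>{S \<in> Pow I. P S}. fib S) = {x \<in> topspace X. P {t \<in> I. x \<in> D t}}"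
    using fib_iff by auto
  ultimately show ?thesis by simp
qed

lemma meas_fun_membership_pattern:
  assumes "is_successor (cardSuc lam) xi" "small I" "\<And>t. t \<in> I \<Longrightarrow> Delta0 xi (D t)"
    and "\<And>S. h S \<in> topspace Y"
  shows "(\<lambda>x\<in>topspace X. h {t \<in> I. x \<in> D t}) \<in> meas_fun lam X Y xi"
  unfolding meas_fun_def
proof (intro CollectI conjI allI impI)
  show "(\<lambda>x\<in>topspace X. h {t \<in> I. x \<in> D t}) \<in> topspace X \<rightarrow>\<^sub>E topspace Y"
    using assms(4) by auto
  fix U
  have "{x \<in> topspace X. (\<lambda>x\<in>topspace X. h {t \<in> I. x \<in> D t}) x \<in> U}
      = {x \<in> topspace X. h {t \<in> I. x \<in> D t} \<in> U}"
    by auto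
  then show "Sig xi {x \<in> topspace X. (\<lambda>x\<in>topspace X. h {t \<in> I. x \<in> D t}) x \<in> U}"
    using Sigma0_membership_pattern[OF assms(1-3), of "\<lambda>t. t" "\<lambda>S. h S \<in> U"] by simp
qed

end

subsection \<open>Pointwise limits of measurable functions\<close>

lemma lam_lim_mono: "F \<subseteq> G \<Longrightarrow> lam_lim lam X Y F \<subseteq> lam_lim lam X Y G"
  unfolding lam_lim_def by blast

lemma subset_lam_lim: "F \<subseteq> topspace X \<rightarrow>\<^sub>E topspace Y \<Longrightarrow> F \<subseteq> lam_lim lam X Y F"
  unfolding lam_lim_def by (fastforce intro!: exI[of _ "\<lambda>_. f" for f])

locale zero_dim_pair = infinite_cardinal lam + X: zero_dim_space lam X + Y: zero_dim_space lam Y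
  for lam :: "'l rel" and X :: "'a topology" and Y :: "'b topology"
begin

lemma meas_funI_clopenin:
  assumes f: "f \<in> topspace X \<rightarrow>\<^sub>E topspace Y" and xi: "level_one \<sqsubseteq> xi"
    and clopen: "\<And>C. clopenin Y C \<Longrightarrow> X.Sig xi {x \<in> topspace X. f x \<in> C}"
  shows "f \<in> meas_fun lam X Y xi"
  unfolding meas_fun_def
proof (intro CollectI conjI f allI impI)
  fix U assume "openin Y U"
  then obtain \<C> where \<C>: "moderate \<C>" "\<And>C. C \<in> \<C> \<Longrightarrow> clopenin Y C" "\<Union>\<C> = U"
    using Y.openin_Union_clopenin by metis
  have "X.Sig xi (\<Union>C\<in>\<C>. {x \<in> topspace X. f x \<in> C})"
    using \<C>(1) clopen[OF \<C>(2)] xi by (rule X.Sigma0_UN)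
  moreover have "(\<Union>C\<in>\<C>. {x \<in> topspace X. f x \<in> C}) = {x \<in> topspace X. f x \<in> U}"
    using \<C>(3) by blast
  ultimately show "X.Sig xi {x \<in> topspace X. f x \<in> U}" by simp
qed

lemma limit_preimage_clopenin:
  assumes lim: "\<And>x. x \<in> S \<Longrightarrow> limitin Y (\<lambda>a. g a x) (f x) (tails lam)" and C: "clopenin Y C"
  shows "{x \<in> S. f x \<in> C} = (\<Union>a\<in>Field lam. {x \<in> S. \<forall>b. (a, b) \<in> lam \<longrightarrow> g b x \<in> C})"
proof -
  have "f x \<in> C \<longleftrightarrow> eventually (\<lambda>a. g a x \<in> C) (tails lam)" if "x \<in> S" for x
  proof
    assume "f x \<in> C"
    then show "eventually (\<lambda>a. g a x \<in> C) (tails lam)"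
      using lim[OF that] C unfolding limitin_def clopenin_def by blast
  next
    assume "eventually (\<lambda>a. g a x \<in> C) (tails lam)"
    then show "f x \<in> C"
      using limitin_closedin[OF lim[OF that]] C tails_nontrivial unfolding clopenin_def by blast
  qed
  then show ?thesis unfolding eventually_tails by blast
qed

lemma meas_fun_INT_tail_Pi0:
  assumes g: "\<And>b. b \<in> Field lam \<Longrightarrow> g b \<in> meas_fun lam X Y xi"
    and xi: "level_one \<sqsubseteq> xi" and C: "closedin Y C"
  shows "X.Pi0 xi {x \<in> topspace X. \<forall>b. (a, b) \<in> lam \<longrightarrow> g b x \<in> C}"
proof -
  have "X.Pi0 xi {x \<in> topspace X. g b x \<in> C}" if b: "b \<in> Field lam" for b
  proof -
    have "X.Sig xi {x \<in> topspace X. g b x \<in> topspace Y - C}"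
      using g[OF b] C unfolding meas_fun_def closedin_def by blast
    moreover have "{x \<in> topspace X. g b x \<in> topspace Y - C}
        = topspace X - {x \<in> topspace X. g b x \<in> C}"
      using g[OF b] unfolding meas_fun_def by auto
    ultimately show ?thesis by (simp add: X.Pi0_def)
  qed
  moreover have "{b. (a, b) \<in> lam} \<subseteq> Field lam" by (auto simp: Field_def)
  ultimately have "X.Pi0 xi (topspace X \<inter> (\<Inter>b\<in>{b. (a, b) \<in> lam}. {x \<in> topspace X. g b x \<in> C}))"
    using moderate_subset[OF _ moderate_Field] xi by (intro X.Pi0_INT) auto
  moreover have "topspace X \<inter> (\<Inter>b\<in>{b. (a, b) \<in> lam}. {x \<in> topspace X. g b x \<in> C})
      = {x \<in> topspace X. \<forall>b. (a, b) \<in> lam \<longrightarrow> g b x \<in> C}"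
    by blast
  ultimately show ?thesis by simp
qed

lemma lam_lim_meas_fun_subset:
  assumes xi: "level_one \<sqsubseteq> xi"
  shows "lam_lim lam X Y (meas_fun lam X Y xi) \<subseteq> meas_fun lam X Y (level_suc xi)"
proof
  fix f assume "f \<in> lam_lim lam X Y (meas_fun lam X Y xi)"
  then obtain g where f: "f \<in> topspace X \<rightarrow>\<^sub>E topspace Y"
    and g: "\<And>a. a \<in> Field lam \<Longrightarrow> g a \<in> meas_fun lam X Y xi"
    and lim: "\<And>x. x \<in> topspace X \<Longrightarrow> limitin Y (\<lambda>a. g a x) (f x) (tails lam)"
    unfolding lam_lim_def by blast
  have "xi \<in> Field (cardSuc lam)" using xi by (auto simp: Field_def)
  then have suc: "level_one \<sqsubseteq> level_suc xi"
    using level.oone_le_is_successor level.is_successor_osuc by blast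
  show "f \<in> meas_fun lam X Y (level_suc xi)"
  proof (rule meas_funI_clopenin[OF f suc])
    fix C assume C: "clopenin Y C"
    define A where "A a = {x \<in> topspace X. \<forall>b. (a, b) \<in> lam \<longrightarrow> g b x \<in> C}" for a
    have "X.Pi0 xi (A a)" for a
      unfolding A_def using meas_fun_INT_tail_Pi0[OF g xi] C by (simp add: clopenin_def)
    moreover have "{x \<in> topspace X. f x \<in> C} = \<Union>(A ` Field lam)"
      unfolding A_def by (rule limit_preimage_clopenin[OF lim C])
    ultimately show "X.Sig (level_suc xi) {x \<in> topspace X. f x \<in> C}"
      unfolding X.Sigma0_suc_iff[OF xi] using moderate_image[OF moderate_Field, of A] by blast
  qed
qed

lemma meas_fun_suc_cover:
  assumes f: "f \<in> meas_fun lam X Y (level_suc xi)" and xi: "level_one \<sqsubseteq> xi"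
    and \<U>: "\<And>U. U \<in> \<U> \<Longrightarrow> openin Y U" "\<Union>\<U> = topspace Y"
  obtains \<F> where "moderate \<F>" "\<Union>\<F> = topspace X"
    "\<And>A. A \<in> \<F> \<Longrightarrow> X.Pi0 xi A \<and> (\<exists>U\<in>\<U>. f ` A \<subseteq> U)"
proof -
  obtain \<V> where \<V>: "\<V> \<subseteq> \<U>" "moderate \<V>" "\<Union>\<V> = \<Union>\<U>"
    using Y.Lindelof[of \<U>] \<U>(1) by blast
  have "X.Sig (level_suc xi) {x \<in> topspace X. f x \<in> V}" if "V \<in> \<V>" for V
    using f subsetD[OF \<V>(1) that] \<U>(1) unfolding meas_fun_def by blast
  then have "\<forall>V\<in>\<V>. \<exists>\<F>. moderate \<F> \<and> {x \<in> topspace X. f x \<in> V} = \<Union>\<F> \<and> (\<forall>A\<in>\<F>. X.Pi0 xi A)"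
    unfolding X.Sigma0_suc_iff[OF xi] by blast
  then obtain F where F: "\<forall>V\<in>\<V>. moderate (F V) \<and> {x \<in> topspace X. f x \<in> V} = \<Union>(F V) \<and>
      (\<forall>A\<in>F V. X.Pi0 xi A)"
    by (rule bchoice[THEN exE])
  show ?thesis
  proof
    show "moderate (\<Union>V\<in>\<V>. F V)" using \<V>(2) F by (intro moderate_UN) blast+
    have f_in: "f x \<in> \<Union>\<V>" if "x \<in> topspace X" for x
      using f that unfolding \<V>(3) \<U>(2) meas_fun_def by blast
    have "\<Union>(\<Union>V\<in>\<V>. F V) = (\<Union>V\<in>\<V>. \<Union>(F V))" by blast
    also have "\<dots> = (\<Union>V\<in>\<V>. {x \<in> topspace X. f x \<in> V})" using F by (intro SUP_cong) auto
    also have "\<dots> = topspace X" using f_in by auto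
    finally show "\<Union>(\<Union>V\<in>\<V>. F V) = topspace X" .
    fix A assume "A \<in> (\<Union>V\<in>\<V>. F V)"
    then obtain V where V: "V \<in> \<V>" "A \<in> F V" by blast
    then have "f ` A \<subseteq> V" "X.Pi0 xi A" using bspec[OF F V(1)] by blast+
    then show "X.Pi0 xi A \<and> (\<exists>U\<in>\<U>. f ` A \<subseteq> U)" using V(1) \<V>(1) by blast
  qed
qed

end

subsection \<open>Refining partitions into open cells\<close>

locale refining_partitions = infinite_cardinal lam for lam :: "'l rel" +
  fixes X :: "'a topology" and cell :: "'l \<Rightarrow> 'a \<Rightarrow> 'a set"
  assumes weight: "weight_le X lam"
    and cell_self: "y \<in> topspace X \<Longrightarrow> y \<in> cell a y"
    and cell_eq: "z \<in> cell a y \<Longrightarrow> y \<in> topspace X \<Longrightarrow> cell a z = cell a y"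
    and cell_antimono: "(a, b) \<in> lam \<Longrightarrow> cell b y \<subseteq> cell a y"
    and openin_cell: "a \<in> Field lam \<Longrightarrow> y \<in> topspace X \<Longrightarrow> openin X (cell a y)"
    and ex_cell_subset: "openin X U \<Longrightarrow> y \<in> U \<Longrightarrow> \<exists>a\<in>Field lam. cell a y \<subseteq> U"
begin

lemma cell_subset: "a \<in> Field lam \<Longrightarrow> y \<in> topspace X \<Longrightarrow> cell a y \<subseteq> topspace X"
  using openin_cell openin_subset by blast

lemma clopenin_cell:
  assumes a: "a \<in> Field lam" and y: "y \<in> topspace X"
  shows "clopenin X (cell a y)"
proof -
  have "topspace X - cell a y = (\<Union>z\<in>topspace X - cell a y. cell a z)"
  proof (intro equalityI subsetI)
    fix w assume "w \<in> (\<Union>z\<in>topspace X - cell a y. cell a z)"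
    then obtain z where z: "z \<in> topspace X" "z \<notin> cell a y" "w \<in> cell a z" by blast
    then have "w \<notin> cell a y" using cell_eq[of w a] cell_self[of z a] y by blast
    then show "w \<in> topspace X - cell a y" using z cell_subset[OF a] by blast
  qed (use cell_self in blast)
  moreover have "openin X (\<Union>z\<in>topspace X - cell a y. cell a z)"
    using openin_cell[OF a] by blast
  ultimately show ?thesis
    using openin_cell[OF a y] cell_subset[OF a y] by (simp add: clopenin_def closedin_def)
qed

sublocale zero_dim_space lam X
proof
  show "\<exists>C. clopenin X C \<and> x \<in> C \<and> C \<subseteq> U" if "openin X U" "x \<in> U" for U x
    using ex_cell_subset[OF that] clopenin_cell cell_self openin_subset[OF that(1)] that(2) by blast
qed (rule weight)

text \<open>
  The value \<open>f x\<close> is located at scale \<open>a\<close> by a \<open>c\<close> with \<open>x \<in> D c j\<close> for all \<open>j\<close>; the failure of a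
  candidate \<open>c\<close> is witnessed by a single \<open>j\<close>.
\<close>

definition resolves ::
    "'x set \<Rightarrow> ('x \<Rightarrow> 'a) \<Rightarrow> 'l \<Rightarrow> ('l \<Rightarrow> 'a) \<Rightarrow> ('l \<Rightarrow> 'l \<Rightarrow> 'x set) \<Rightarrow> bool" where
  "resolves S f a pt D \<longleftrightarrow> range pt \<subseteq> topspace X \<and>
    (\<forall>x\<in>S. \<exists>c\<in>Field lam. \<forall>j\<in>Field lam. x \<in> D c j) \<and>
    (\<forall>x\<in>S. \<forall>c. (\<forall>j\<in>Field lam. x \<in> D c j) \<longrightarrow> f x \<in> cell a (pt c))"

end

locale spherical_partitions = refining_partitions lam X cell
  for lam :: "'l rel" and X :: "'a topology" and cell :: "'l \<Rightarrow> 'a \<Rightarrow> 'a set" +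
  assumes ex_in_all_cells:
    "T \<subseteq> Field lam \<Longrightarrow> T \<noteq> {} \<Longrightarrow> (\<And>a. a \<in> T \<Longrightarrow> pt a \<in> topspace X) \<Longrightarrow>
      (\<And>a b. a \<in> T \<Longrightarrow> b \<in> T \<Longrightarrow> (a, b) \<in> lam \<Longrightarrow> cell b (pt b) \<subseteq> cell a (pt a)) \<Longrightarrow>
      \<exists>y\<in>topspace X. \<forall>a\<in>T. y \<in> cell a (pt a)"
begin

definition coherent_at :: "('l \<Rightarrow> 'a) \<Rightarrow> 'l \<Rightarrow> bool" where
  "coherent_at pt a \<longleftrightarrow> (\<exists>z. \<forall>b\<in>under lam a. z \<in> cell b (pt b))"

lemma ex_in_coherent_cells:
  assumes pt: "\<And>a. a \<in> Field lam \<Longrightarrow> pt a \<in> topspace X" and B: "B \<subseteq> Field lam"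
    and ne: "topspace X \<noteq> {}"
  shows "\<exists>y\<in>topspace X. \<forall>a\<in>B. coherent_at pt a \<longrightarrow> y \<in> cell a (pt a)"
proof (cases "\<exists>a\<in>B. coherent_at pt a")
  case True
  define T where "T = {a \<in> B. coherent_at pt a}"
  have T: "T \<subseteq> Field lam" "T \<noteq> {}" using B True unfolding T_def by blast+
  have "cell b (pt b) \<subseteq> cell a (pt a)" if ab: "a \<in> T" "b \<in> T" "(a, b) \<in> lam" for a b
  proof -
    have ab_Field: "a \<in> Field lam" "b \<in> Field lam" using ab T(1) by blast+
    obtain z where "\<forall>c\<in>under lam b. z \<in> cell c (pt c)"
      using ab(2) unfolding T_def coherent_at_def by blast
    then have "z \<in> cell b (pt b)" "z \<in> cell a (pt a)"
      using ab(3) Refl_under_in[OF lam.REFL ab_Field(2)] by (auto simp: under_def)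
    then have "cell b z = cell b (pt b)" "cell a z = cell a (pt a)"
      using cell_eq pt ab_Field by blast+
    then show ?thesis using cell_antimono[OF ab(3)] by metis
  qed
  then have "\<exists>y\<in>topspace X. \<forall>a\<in>T. y \<in> cell a (pt a)"
    using pt T by (intro ex_in_all_cells) blast+
  then show ?thesis unfolding T_def by blast
qed (use ne in blast)

end

subsection \<open>Approximation by functions of few membership patterns\<close>

locale resolved_function = regular_cardinal lam + Y: spherical_partitions lam Y cell
  for lam :: "'l rel" and Y :: "'b topology" and cell :: "'l \<Rightarrow> 'b \<Rightarrow> 'b set" +
  fixes S :: "'x set" and f :: "'x \<Rightarrow> 'b" and pt :: "'l \<Rightarrow> 'l \<Rightarrow> 'b"
    and D :: "'l \<Rightarrow> 'l \<Rightarrow> 'l \<Rightarrow> 'x set"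
  assumes resolves: "a \<in> Field lam \<Longrightarrow> Y.resolves S f a (pt a) (D a)"
begin

lemma pt_in_topspace: "a \<in> Field lam \<Longrightarrow> pt a c \<in> topspace Y"
  using resolves unfolding Y.resolves_def by blast

lemma ex_code:
  "a \<in> Field lam \<Longrightarrow> x \<in> S \<Longrightarrow> \<exists>c\<in>Field lam. \<forall>j\<in>Field lam. x \<in> D a c j"
  using resolves unfolding Y.resolves_def by blast

lemma in_cell_if_code:
  "a \<in> Field lam \<Longrightarrow> x \<in> S \<Longrightarrow> (\<And>j. j \<in> Field lam \<Longrightarrow> x \<in> D a c j) \<Longrightarrow> f x \<in> cell a (pt a c)"
  using resolves unfolding Y.resolves_def by blast

definition tests :: "'l \<Rightarrow> ('l \<times> 'l \<times> 'l) set" where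
  "tests b = underS lam b \<times> underS lam b \<times> underS lam b"

definition test_set :: "'l \<times> 'l \<times> 'l \<Rightarrow> 'x set" where
  "test_set = (\<lambda>(a, c, j). D a c j)"

definition passed :: "'l \<Rightarrow> 'x \<Rightarrow> ('l \<times> 'l \<times> 'l) set" where
  "passed b x = {t \<in> tests b. x \<in> test_set t}"

text \<open>
  If no \<open>c < b\<close> is left, \<^const>\<open>wo_rel.minim\<close> of the empty set is junk; this is harmless, as every guess
  is eventually correct.
\<close>

definition guess :: "'l \<Rightarrow> ('l \<times> 'l \<times> 'l) set \<Rightarrow> 'l \<Rightarrow> 'l" where
  "guess b P a = lam.minim {c \<in> underS lam b. \<forall>j\<in>underS lam b. (a, c, j) \<in> P}"

definition guess_pt :: "'l \<Rightarrow> ('l \<times> 'l \<times> 'l) set \<Rightarrow> 'l \<Rightarrow> 'b" where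
  "guess_pt b P a = pt a (guess b P a)"

definition select :: "'l \<Rightarrow> ('l \<times> 'l \<times> 'l) set \<Rightarrow> 'b" where
  "select b P = (SOME y. y \<in> topspace Y \<and>
    (\<forall>a\<in>underS lam b. Y.coherent_at (guess_pt b P) a \<longrightarrow> y \<in> cell a (guess_pt b P a)))"

definition approx :: "'l \<Rightarrow> 'x \<Rightarrow> 'b" where
  "approx b = (\<lambda>x\<in>S. select b (passed b x))"

lemma small_tests: "b \<in> Field lam \<Longrightarrow> small (tests b)"
  unfolding tests_def by (intro small_Sigma small_underS)

lemma guess_pt_in_topspace: "a \<in> Field lam \<Longrightarrow> guess_pt b P a \<in> topspace Y"
  unfolding guess_pt_def by (rule pt_in_topspace)

lemma select_in_coherent_cells:
  "select b P \<in> topspace Y \<and>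
    (\<forall>a\<in>underS lam b. Y.coherent_at (guess_pt b P) a \<longrightarrow> select b P \<in> cell a (guess_pt b P a))"
proof -
  have "underS lam b \<subseteq> Field lam" by (auto simp: underS_Field)
  moreover have "topspace Y \<noteq> {}" using pt_in_topspace[OF lam.ozero_in_Field] by blast
  ultimately have "\<exists>y\<in>topspace Y. \<forall>a\<in>underS lam b.
      Y.coherent_at (guess_pt b P) a \<longrightarrow> y \<in> cell a (guess_pt b P a)"
    using guess_pt_in_topspace by (intro Y.ex_in_coherent_cells)
  then show ?thesis unfolding select_def Bex_def by (rule someI_ex)
qed

lemma passed_iff:
  "a \<in> underS lam b \<Longrightarrow> c \<in> underS lam b \<Longrightarrow> j \<in> underS lam b \<Longrightarrow>
    (a, c, j) \<in> passed b x \<longleftrightarrow> x \<in> D a c j"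
  by (simp add: passed_def tests_def test_set_def)

lemma guess_eqI:
  assumes a: "a \<in> underS lam b" and c: "c \<in> underS lam b"
    and pass: "\<And>j. j \<in> Field lam \<Longrightarrow> x \<in> D a c j"
    and fail: "\<And>c'. c' \<in> underS lam c \<Longrightarrow> \<exists>j\<in>underS lam b. x \<notin> D a c' j"
  shows "guess b (passed b x) a = c"
  unfolding guess_def
proof (rule lam.equals_minim[symmetric])
  let ?candidates = "{c \<in> underS lam b. \<forall>j\<in>underS lam b. (a, c, j) \<in> passed b x}"
  show "?candidates \<subseteq> Field lam" by (auto simp: underS_Field)
  show "c \<in> ?candidates" using a c pass passed_iff by (auto simp: underS_Field)
  fix c' assume c': "c' \<in> ?candidates"
  then have "c' \<notin> underS lam c" using fail passed_iff[OF a] by blast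
  then show "(c, c') \<in> lam"
    using lam.not_le_iff_less[of c c'] c c' by (auto simp: underS_Field)
qed

lemma eventually_in_guessed_cell:
  assumes a: "a \<in> Field lam" and x: "x \<in> S"
  shows "eventually (\<lambda>b. a \<in> underS lam b \<and> f x \<in> cell a (guess_pt b (passed b x) a)) (tails lam)"
proof -
  define C where "C = {c \<in> Field lam. \<forall>j\<in>Field lam. x \<in> D a c j}"
  define c where "c = lam.minim C"
  have C: "C \<subseteq> Field lam" "C \<noteq> {}" using ex_code[OF a x] unfolding C_def by blast+
  then have "c \<in> C" unfolding c_def by (rule lam.minim_in)
  then have c: "c \<in> Field lam" "\<And>j. j \<in> Field lam \<Longrightarrow> x \<in> D a c j" unfolding C_def by auto
  have "eventually (\<lambda>b. \<exists>j\<in>underS lam b. x \<notin> D a c' j) (tails lam)"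
    if c': "c' \<in> underS lam c" for c'
  proof -
    have c'_Field: "c' \<in> Field lam" using c' by (rule underS_Field)
    then have "c' \<notin> C"
      using c' lam.minim_least[OF C(1)] lam.not_le_iff_less[OF c(1)] unfolding c_def by blast
    then obtain j where j: "j \<in> Field lam" "x \<notin> D a c' j" using c'_Field unfolding C_def by blast
    show ?thesis using eventually_tails_greater[OF j(1)] by eventually_elim (use j(2) in blast)
  qed
  then have "eventually (\<lambda>b. \<forall>c'\<in>underS lam c. \<exists>j\<in>underS lam b. x \<notin> D a c' j) (tails lam)"
    by (rule eventually_tails_small_ball[OF small_underS[OF c(1)]])
  then show ?thesis
    using eventually_tails_greater[OF a] eventually_tails_greater[OF c(1)]
  proof eventually_elim
    case (elim b)
    then have "guess b (passed b x) a = c" using c(2) by (intro guess_eqI) blast+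
    then show ?case using elim(2) in_cell_if_code[OF a x c(2)] by (simp add: guess_pt_def)
  qed
qed

lemma limitin_approx:
  assumes x: "x \<in> S"
  shows "limitin Y (\<lambda>b. approx b x) (f x) (tails lam)"
  unfolding limitin_def
proof (intro conjI allI impI)
  obtain c where "f x \<in> cell (ozero lam) (pt (ozero lam) c)"
    using ex_code[OF lam.ozero_in_Field x] in_cell_if_code[OF lam.ozero_in_Field x] by blast
  then show fx: "f x \<in> topspace Y"
    using Y.cell_subset[OF lam.ozero_in_Field pt_in_topspace[OF lam.ozero_in_Field]] by blast
  fix U assume "openin Y U \<and> f x \<in> U"
  then obtain a where a: "a \<in> Field lam" "cell a (f x) \<subseteq> U" using Y.ex_cell_subset by blast
  have "eventually (\<lambda>b. \<forall>a'\<in>under lam a.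
      a' \<in> underS lam b \<and> f x \<in> cell a' (guess_pt b (passed b x) a')) (tails lam)"
    using small_under[OF a(1)] eventually_in_guessed_cell[OF _ x]
    by (rule eventually_tails_small_ball) (auto simp: under_def Field_def)
  then show "eventually (\<lambda>b. approx b x \<in> U) (tails lam)"
  proof eventually_elim
    case (elim b)
    have "a \<in> under lam a" using Refl_under_in[OF lam.REFL a(1)] .
    moreover have "Y.coherent_at (guess_pt b (passed b x)) a"
      using elim unfolding Y.coherent_at_def by blast
    ultimately have "approx b x \<in> cell a (guess_pt b (passed b x) a)"
      using elim select_in_coherent_cells x unfolding approx_def by auto
    also have "\<dots> = cell a (f x)"
      using elim \<open>a \<in> under lam a\<close> Y.cell_eq guess_pt_in_topspace[OF a(1)] by blast
    finally show ?case using a(2) by blast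
  qed
qed

end

locale measurable_limits = two_lt_cardinal lam + zero_dim_pair lam X Y +
  X: additive_space lam X + Y: spherical_partitions lam Y cell
  for lam :: "'l rel" and X :: "'a topology" and Y :: "'b topology"
    and cell :: "'l \<Rightarrow> 'b \<Rightarrow> 'b set"
begin

lemma ex_resolution:
  assumes f: "f \<in> meas_fun lam X Y (level_suc xi)" and xi: "level_one \<sqsubseteq> xi"
    and ne: "topspace X \<noteq> {}" and a: "a \<in> Field lam"
  shows "\<exists>pt D. Y.resolves (topspace X) f a pt D \<and> (\<forall>c j. X.Delta0_successor xi (D c j))"
proof -
  have "openin Y U" if "U \<in> cell a ` topspace Y" for U using that Y.openin_cell[OF a] by blast
  moreover have "\<Union>(cell a ` topspace Y) = topspace Y"
    using Y.cell_self Y.cell_subset[OF a] by blast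
  ultimately obtain \<F> where \<F>: "moderate \<F>" "\<Union>\<F> = topspace X"
    "\<And>A. A \<in> \<F> \<Longrightarrow> X.Pi0 xi A \<and> (\<exists>U\<in>cell a ` topspace Y. f ` A \<subseteq> U)"
    using meas_fun_suc_cover[OF f xi] by metis
  then obtain e where e: "\<And>c. e c \<in> \<F>" "e ` Field lam = \<F>"
    using moderate_enum[OF \<F>(1)] ne by blast
  have "\<exists>y\<in>topspace Y. \<forall>x\<in>e c. f x \<in> cell a y" for c using \<F>(3)[OF e(1)] by blast
  then obtain pt where pt: "\<And>c. pt c \<in> topspace Y" "\<And>c x. x \<in> e c \<Longrightarrow> f x \<in> cell a (pt c)"
    by metis
  have "\<exists>D. e c = topspace X \<inter> (\<Inter>j\<in>Field lam. D j) \<and> (\<forall>j. X.Delta0_successor xi (D j))" for c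
    using X.Pi0_INT_Delta0_successor \<F>(3)[OF e(1)] by metis
  then obtain D where D: "\<And>c. e c = topspace X \<inter> (\<Inter>j\<in>Field lam. D c j)"
    "\<And>c j. X.Delta0_successor xi (D c j)" by metis
  have code: "x \<in> e c \<longleftrightarrow> (\<forall>j\<in>Field lam. x \<in> D c j)" if "x \<in> topspace X" for x c
    using that D(1) by blast
  have "\<exists>c\<in>Field lam. x \<in> e c" if "x \<in> topspace X" for x
    using that unfolding \<F>(2)[symmetric] e(2)[symmetric] by blast
  then have "Y.resolves (topspace X) f a pt D"
    unfolding Y.resolves_def using pt code by (auto simp: image_subset_iff)
  then show ?thesis using D(2) by blast
qed

lemma resolved_function_in_lam_lim:
  assumes xi: "admissible_level xi" and f: "f \<in> topspace X \<rightarrow>\<^sub>E topspace Y"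
    and resolved: "resolved_function lam Y cell (topspace X) f pt D"
    and D: "\<And>a c j. a \<in> Field lam \<Longrightarrow> X.Delta0_successor xi (D a c j)"
  shows "f \<in> lam_lim lam X Y (\<Union>zeta\<in>successor_levels xi. meas_fun lam X Y zeta)"
proof -
  interpret resolved_function lam Y cell "topspace X" f pt D by (rule resolved)
  have "approx b \<in> (\<Union>zeta\<in>successor_levels xi. meas_fun lam X Y zeta)" if b: "b \<in> Field lam" for b
  proof -
    have "X.Delta0_successor xi (test_set t)" if "t \<in> tests b" for t
      using D that underS_Field unfolding tests_def test_set_def by fastforce
    then obtain zeta where zeta: "zeta \<in> successor_levels xi"
      "\<And>t. t \<in> tests b \<Longrightarrow> X.Delta0 zeta (test_set t)"
      using X.Delta0_successor_common_level[OF xi small_tests[OF b]] by metis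
    then have "approx b \<in> meas_fun lam X Y zeta"
      using X.meas_fun_membership_pattern[OF _ small_tests[OF b], of zeta test_set "select b"]
        select_in_coherent_cells unfolding approx_def passed_def successor_levels_def by blast
    then show ?thesis using zeta(1) by blast
  qed
  then show ?thesis unfolding lam_lim_def using f limitin_approx by blast
qed

lemma meas_fun_suc_subset_lam_lim:
  assumes xi: "level_one \<sqsubseteq> xi" "admissible_level xi"
  shows "meas_fun lam X Y (level_suc xi)
    \<subseteq> lam_lim lam X Y (\<Union>zeta\<in>successor_levels xi. meas_fun lam X Y zeta)"
proof
  fix f assume f: "f \<in> meas_fun lam X Y (level_suc xi)"
  then have f_PiE: "f \<in> topspace X \<rightarrow>\<^sub>E topspace Y" unfolding meas_fun_def by blast
  show "f \<in> lam_lim lam X Y (\<Union>zeta\<in>successor_levels xi. meas_fun lam X Y zeta)"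
  proof (cases "topspace X = {}")
    case True
    have "f \<in> meas_fun lam X Y level_one"
      using X.meas_fun_empty_topspace[OF True level.oone_le_is_successor[OF level.is_successor_oone]]
        f_PiE by blast
    then have "f \<in> (\<Union>zeta\<in>successor_levels xi. meas_fun lam X Y zeta)"
      using level_one_in_successor_levels[OF xi(1)] by blast
    then show ?thesis
      using subset_lam_lim[of "\<Union>zeta\<in>successor_levels xi. meas_fun lam X Y zeta" X Y lam]
      unfolding meas_fun_def by blast
  next
    case False
    obtain pt D where "\<And>a. a \<in> Field lam \<Longrightarrow> Y.resolves (topspace X) f a (pt a) (D a)"
      and D: "\<And>a c j. a \<in> Field lam \<Longrightarrow> X.Delta0_successor xi (D a c j)"
      using ex_resolution[OF f xi(1) False] by metis
    then have "resolved_function lam Y cell (topspace X) f pt D" by unfold_locales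
    then show ?thesis using D by (rule resolved_function_in_lam_lim[OF xi(2) f_PiE])
  qed
qed

lemma meas_fun_suc_eq_lam_lim:
  assumes xi: "level_one \<sqsubseteq> xi" "admissible_level xi"
    and F: "(\<Union>zeta\<in>successor_levels xi. meas_fun lam X Y zeta) \<subseteq> F" "F \<subseteq> meas_fun lam X Y xi"
  shows "meas_fun lam X Y (level_suc xi) = lam_lim lam X Y F"
  using meas_fun_suc_subset_lam_lim[OF xi] lam_lim_meas_fun_subset[OF xi(1)]
    lam_lim_mono[OF F(1), of lam X Y] lam_lim_mono[OF F(2), of lam X Y] by blast

end

subsection \<open>Metrics over an ordered field\<close>

definition much_less :: "'g::linordered_field \<Rightarrow> 'g \<Rightarrow> bool" where
  "much_less x r \<longleftrightarrow> (\<forall>n. of_nat n * x < r)"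

lemma much_less_imp_less: "much_less x r \<Longrightarrow> x < r"
  unfolding much_less_def by (drule spec[of _ 1]) simp

lemma much_less_zero: "much_less 0 r \<longleftrightarrow> 0 < r"
  by (simp add: much_less_def)

lemma much_less_antimono: "much_less x r \<Longrightarrow> y \<le> x \<Longrightarrow> much_less y r"
  unfolding much_less_def by (meson le_less_trans mult_left_mono of_nat_0_le_iff)

lemma much_less_add:
  assumes "much_less x r" "much_less y r"
  shows "much_less (x + y) r"
  unfolding much_less_def
proof
  fix n
  have "of_nat (2 * n) * x < r" "of_nat (2 * n) * y < r"
    using assms unfolding much_less_def by blast+
  then show "of_nat n * (x + y) < r" by (simp add: distrib_left)
qed

locale G_metric_space = regular_cardinal lam for lam :: "'l rel" +
  fixes X :: "'a topology" and d :: "'a \<Rightarrow> 'a \<Rightarrow> 'g::linordered_field"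
  assumes uncountable: "natLeq <o lam"
    and coinitiality: "has_coinitiality TYPE('g) lam"
    and metric: "compatible_G_metric X d"
    and weight: "weight_le X lam"
begin

lemma d_nonneg: "x \<in> topspace X \<Longrightarrow> y \<in> topspace X \<Longrightarrow> 0 \<le> d x y"
  and d_zero: "x \<in> topspace X \<Longrightarrow> y \<in> topspace X \<Longrightarrow> d x y = 0 \<longleftrightarrow> x = y"
  and d_commute: "x \<in> topspace X \<Longrightarrow> y \<in> topspace X \<Longrightarrow> d x y = d y x"
  and d_triangle: "x \<in> topspace X \<Longrightarrow> y \<in> topspace X \<Longrightarrow> z \<in> topspace X \<Longrightarrow> d x z \<le> d x y + d y z"
  using metric unfolding compatible_G_metric_def G_metric_def by simp_all

lemma openin_iff:
  "openin X U \<longleftrightarrow> U \<subseteq> topspace X \<and>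
     (\<forall>x\<in>U. \<exists>r>0. \<forall>y\<in>topspace X. d x y < r \<longrightarrow> y \<in> U)"
proof -
  have "G_ball (topspace X) d x r \<subseteq> U \<longleftrightarrow> (\<forall>y\<in>topspace X. d x y < r \<longrightarrow> y \<in> U)" for x r
    unfolding G_ball_def by blast
  then show ?thesis using metric unfolding compatible_G_metric_def by simp
qed

lemma openin_contains_cball:
  assumes "openin X U" "x \<in> U"
  shows "\<exists>r>0. G_cball (topspace X) d x r \<subseteq> U"
proof -
  obtain r where r: "r > 0" "\<And>y. y \<in> topspace X \<Longrightarrow> d x y < r \<Longrightarrow> y \<in> U"
    using assms unfolding openin_iff by blast
  have "r / 2 < r" using r(1) by simp
  then have "G_cball (topspace X) d x (r / 2) \<subseteq> U"
    using r(2) le_less_trans unfolding G_cball_def by blast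
  then show ?thesis using half_gt_zero[OF r(1)] by blast
qed

lemma ex_small_lower_bound:
  fixes K :: "'g set"
  assumes "small K" "K \<subseteq> {0<..}"
  shows "\<exists>e>0. \<forall>k\<in>K. e < k"
proof -
  have "\<not> positive_coinitial K"
    using assms(1) coinitiality not_ordLess_ordLeq unfolding has_coinitiality_def by blast
  then show ?thesis
    using assms(2) unfolding positive_coinitial_def by (meson not_le)
qed

lemma ex_small_much_less:
  fixes K :: "'g set"
  assumes "small K" "K \<subseteq> {0<..}"
  shows "\<exists>e>0. \<forall>k\<in>K. much_less e k"
proof -
  define fractions where "fractions = (\<Union>k\<in>K. range (\<lambda>n. k / of_nat (Suc n)))"
  have "small (UNIV :: nat set)"
    using uncountable card_of_nat ordIso_ordLess_trans by blast
  then have "small fractions"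
    unfolding fractions_def by (intro small_UN small_image assms(1))
  moreover have "fractions \<subseteq> {0<..}"
    using assms(2) unfolding fractions_def by (auto intro!: divide_pos_pos simp del: of_nat_Suc)
  ultimately obtain e where e: "e > 0" "\<forall>r\<in>fractions. e < r"
    using ex_small_lower_bound by blast
  have "of_nat n * e < k" if k: "k \<in> K" for k n
  proof (cases n)
    case 0
    then show ?thesis using k assms(2) by auto
  next
    case (Suc m)
    then have "e < k / of_nat n" using e(2) k unfolding fractions_def by blast
    then show ?thesis using Suc by (simp add: pos_less_divide_eq mult.commute del: of_nat_Suc)
  qed
  then show ?thesis using e(1) unfolding much_less_def by blast
qed

lemma openin_small_Inter:
  assumes "small \<U>" "\<And>U. U \<in> \<U> \<Longrightarrow> openin X U"
  shows "openin X (topspace X \<inter> \<Inter>\<U>)"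
  unfolding openin_iff
proof (intro conjI ballI)
  fix x assume x: "x \<in> topspace X \<inter> \<Inter>\<U>"
  have "\<forall>U\<in>\<U>. \<exists>r>0. \<forall>y\<in>topspace X. d x y < r \<longrightarrow> y \<in> U"
    using assms(2) x unfolding openin_iff by blast
  then obtain r where r: "\<And>U. U \<in> \<U> \<Longrightarrow> r U > 0"
    "\<And>U y. U \<in> \<U> \<Longrightarrow> y \<in> topspace X \<Longrightarrow> d x y < r U \<Longrightarrow> y \<in> U"
    by metis
  obtain e where "e > 0" "\<forall>k\<in>r ` \<U>. e < k"
    using ex_small_lower_bound[OF small_image[OF assms(1)], of r] r(1) by blast
  then show "\<exists>r>0. \<forall>y\<in>topspace X. d x y < r \<longrightarrow> y \<in> topspace X \<inter> \<Inter>\<U>"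
    using r(2) by (intro exI[of _ e]) force
qed auto

definition scale :: "'l \<Rightarrow> 'g" where
  "scale = (SOME k. range k \<subseteq> {0<..} \<and> (\<forall>e>0. \<exists>a\<in>Field lam. k a \<le> e))"

lemma scale_positive_coinitial: "range scale \<subseteq> {0<..} \<and> (\<forall>e>0. \<exists>a\<in>Field lam. scale a \<le> e)"
proof -
  obtain K :: "'g set" where K: "positive_coinitial K" "|K| =o lam"
    using coinitiality unfolding has_coinitiality_def by blast
  have "moderate K" using K(2) ordIso_imp_ordLeq by blast
  moreover have "K \<noteq> {}" using K(1) zero_less_one unfolding positive_coinitial_def by blast
  ultimately obtain k where k: "\<And>a. k a \<in> K" "k ` Field lam = K" using moderate_enum by metis
  then have "\<exists>k :: 'l \<Rightarrow> 'g. range k \<subseteq> {0<..} \<and> (\<forall>e>0. \<exists>a\<in>Field lam. k a \<le> e)"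
    using K(1) unfolding positive_coinitial_def by (intro exI[of _ k]) blast
  then show ?thesis unfolding scale_def by (rule someI_ex)
qed

lemma scale_pos: "0 < scale a"
  using scale_positive_coinitial by (auto simp: image_subset_iff)

lemma scale_coinitial: "0 < e \<Longrightarrow> \<exists>a\<in>Field lam. scale a \<le> e"
  using scale_positive_coinitial by blast

text \<open>
  With \<^const>\<open>much_less\<close> in place of \<open><\<close>, being near is transitive; its classes are still open, since
  \<open>\<lambda>\<close> is regular and uncountable.
\<close>

definition near_class :: "'l \<Rightarrow> 'a \<Rightarrow> 'a set" where
  "near_class a y = {z \<in> topspace X. \<forall>b\<in>under lam a. much_less (d y z) (scale b)}"

lemma near_class_self: "y \<in> topspace X \<Longrightarrow> y \<in> near_class a y"
  using d_zero[of y y] scale_pos by (simp add: near_class_def much_less_zero)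

lemma near_class_commute:
  "z \<in> near_class a y \<Longrightarrow> y \<in> topspace X \<Longrightarrow> y \<in> near_class a z"
  unfolding near_class_def using d_commute[of y z] by simp

lemma near_class_trans:
  assumes "z \<in> near_class a y" "w \<in> near_class a z" "y \<in> topspace X"
  shows "w \<in> near_class a y"
  using assms d_triangle[of y z w] much_less_antimono[OF much_less_add]
  unfolding near_class_def by blast

lemma near_class_eq:
  assumes "z \<in> near_class a y" "y \<in> topspace X"
  shows "near_class a z = near_class a y"
proof -
  have "z \<in> topspace X" using assms(1) unfolding near_class_def by blast
  then show ?thesis
    using assms near_class_commute[OF assms] near_class_trans by blast
qed

lemma openin_near_class:
  assumes "a \<in> Field lam" "y \<in> topspace X"
  shows "openin X (near_class a y)"
  unfolding openin_iff
proof (intro conjI ballI)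
  fix z assume z: "z \<in> near_class a y"
  obtain e where e: "e > 0" "\<forall>k\<in>scale ` under lam a. much_less e k"
    using ex_small_much_less[OF small_image[OF small_under[OF assms(1)]]] scale_pos by blast
  have "w \<in> near_class a y" if "w \<in> topspace X" "d z w < e" for w
  proof -
    have "w \<in> near_class a z"
      using e(2) that much_less_antimono[OF _ less_imp_le] unfolding near_class_def by blast
    then show ?thesis using near_class_eq[OF z assms(2)] by blast
  qed
  then show "\<exists>r>0. \<forall>w\<in>topspace X. d z w < r \<longrightarrow> w \<in> near_class a y" using e(1) by blast
qed (auto simp: near_class_def)

sublocale refining_partitions lam X near_class
proof
  show "near_class b y \<subseteq> near_class a y" if "(a, b) \<in> lam" for a b y
    using under_incr[OF lam.TRANS that] unfolding near_class_def by blast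
  show "\<exists>a\<in>Field lam. near_class a y \<subseteq> U" if U: "openin X U" "y \<in> U" for U y
  proof -
    obtain r where r: "r > 0" "\<And>z. z \<in> topspace X \<Longrightarrow> d y z < r \<Longrightarrow> z \<in> U"
      using U unfolding openin_iff by blast
    obtain a where a: "a \<in> Field lam" "scale a \<le> r" using scale_coinitial[OF r(1)] by blast
    have "d y z < r" if "z \<in> near_class a y" for z
      using that a much_less_imp_less[of "d y z" "scale a"] Refl_under_in[OF lam.REFL a(1)]
      unfolding near_class_def by force
    then show ?thesis using r(2) a(1) unfolding near_class_def by blast
  qed
qed (fact weight near_class_self near_class_eq openin_near_class)+

lemma ex_cball_between:
  assumes "p \<in> topspace X" "q \<in> topspace X" "near_class b q \<subset> near_class a p"
  shows "\<exists>c\<in>topspace X. \<exists>r>0. near_class b q \<subseteq> G_cball (topspace X) d c r \<and>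
    G_cball (topspace X) d c r \<subseteq> near_class a p"
proof -
  obtain z where z: "z \<in> near_class a p" "z \<notin> near_class b q" using assms(3) by blast
  have zX: "z \<in> topspace X" using z(1) unfolding near_class_def by blast
  have "near_class a q = near_class a p"
    using near_class_eq near_class_self assms by blast
  then have za: "z \<in> near_class a q" using z(1) by simp
  have "z \<noteq> q" using z(2) near_class_self[OF assms(2)] by blast
  then have pos: "0 < d q z" using d_nonneg[OF assms(2) zX] d_zero[OF assms(2) zX] by auto
  obtain c n where c: "c \<in> under lam b" "scale c \<le> of_nat n * d q z"
    using z(2) zX unfolding near_class_def much_less_def by (auto simp: not_less)
  have "d q w < d q z" if "w \<in> near_class b q" for w
  proof -
    have "of_nat n * d q w < scale c"
      using that c(1) unfolding near_class_def much_less_def by blast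
    then have "of_nat n * d q w < of_nat n * d q z" using c(2) by (rule less_le_trans)
    then show ?thesis by (rule mult_left_less_imp_less) simp
  qed
  then have "near_class b q \<subseteq> G_cball (topspace X) d q (d q z)"
    unfolding G_cball_def near_class_def by force
  moreover have "G_cball (topspace X) d q (d q z) \<subseteq> near_class a q"
    using za much_less_antimono unfolding G_cball_def near_class_def by blast
  ultimately show ?thesis using \<open>near_class a q = near_class a p\<close> assms(2) pos by auto
qed

lemma ex_cball_above_smaller_classes:
  assumes classes: "\<Q> \<subseteq> (\<Union>a\<in>Field lam. near_class a ` topspace X)"
    and wo: "Well_order (superset_order \<Q>)" and Q: "Q \<in> \<Q>"
  shows "\<exists>c\<in>topspace X. \<exists>r>0. G_cball (topspace X) d c r \<subseteq> Q \<and>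
    (\<forall>R\<in>\<Q>. R \<subset> Q \<longrightarrow> R \<subseteq> G_cball (topspace X) d c r)"
proof -
  obtain a p where ap: "a \<in> Field lam" "p \<in> topspace X" "Q = near_class a p"
    using classes Q by blast
  show ?thesis
  proof (cases "{R \<in> \<Q>. R \<subset> Q} = {}")
    case True
    have "openin X Q" "p \<in> Q"
      using openin_near_class near_class_self ap by blast+
    then obtain r where "r > 0" "G_cball (topspace X) d p r \<subseteq> Q"
      using openin_contains_cball by blast
    moreover have "\<not> R \<subset> Q" if "R \<in> \<Q>" for R using True that by blast
    ultimately show ?thesis using ap(2) by blast
  next
    case False
    then have "\<exists>M\<in>{R \<in> \<Q>. R \<subset> Q}. \<forall>R\<in>{R \<in> \<Q>. R \<subset> Q}. R \<subseteq> M"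
      by (intro wo[unfolded Well_order_superset_order_iff, rule_format]) auto
    then obtain M where M: "M \<in> \<Q>" "M \<subset> Q" "\<And>R. R \<in> \<Q> \<Longrightarrow> R \<subset> Q \<Longrightarrow> R \<subseteq> M"
      by auto
    obtain b q where "q \<in> topspace X" "M = near_class b q" using classes M(1) by blast
    then obtain c r where "c \<in> topspace X" "r > 0" "M \<subseteq> G_cball (topspace X) d c r"
      "G_cball (topspace X) d c r \<subseteq> Q"
      using ex_cball_between[OF ap(2)] M(2) ap(3) by blast
    then show ?thesis using M(3) by blast
  qed
qed

end

subsection \<open>Spherical completeness\<close>

lemma spherically_complete_metric_Inter:
  assumes "spherically_complete_metric S d"
    and \<Q>: "Well_order (superset_order \<Q>)" "\<Q> \<noteq> {}"
    and cball: "\<And>Q. Q \<in> \<Q> \<Longrightarrow> \<exists>c\<in>S. \<exists>r>0. G_cball S d c r \<subseteq> Q \<and>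
      (\<forall>R\<in>\<Q>. R \<subset> Q \<longrightarrow> R \<subseteq> G_cball S d c r)"
  shows "\<Inter>\<Q> \<noteq> {}"
proof -
  obtain c r where cr: "\<And>Q. Q \<in> \<Q> \<Longrightarrow> c Q \<in> S \<and> 0 < r Q"
    "\<And>Q. Q \<in> \<Q> \<Longrightarrow> G_cball S d (c Q) (r Q) \<subseteq> Q"
    "\<And>Q R. Q \<in> \<Q> \<Longrightarrow> R \<in> \<Q> \<Longrightarrow> R \<subset> Q \<Longrightarrow> R \<subseteq> G_cball S d (c Q) (r Q)"
    using cball by metis
  have "G_cball S d (c R) (r R) \<subseteq> G_cball S d (c Q) (r Q)" if "(Q, R) \<in> superset_order \<Q>" for Q R
    using that cr(2,3) unfolding superset_order_def by (cases "Q = R") blast+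
  then have "(\<Inter>Q\<in>Field (superset_order \<Q>). G_cball S d (c Q) (r Q)) \<noteq> {}"
    using \<Q> cr(1)
    by (intro assms(1)[unfolded spherically_complete_metric_def, rule_format])
      (auto simp: Field_superset_order)
  then show ?thesis using cr(2) unfolding Field_superset_order by blast
qed

locale spherically_complete_space = G_metric_space lam X d
  for lam :: "'l rel" and X :: "'a topology" and d :: "'a \<Rightarrow> 'a \<Rightarrow> 'g::linordered_field" +
  assumes spherical: "spherically_complete_metric (topspace X) d"
begin

lemma ex_in_all_near_classes:
  assumes T: "T \<subseteq> Field lam" "T \<noteq> {}" and pt: "\<And>a. a \<in> T \<Longrightarrow> pt a \<in> topspace X"
    and anti: "\<And>a b. a \<in> T \<Longrightarrow> b \<in> T \<Longrightarrow> (a, b) \<in> lam \<Longrightarrow> near_class b (pt b) \<subseteq> near_class a (pt a)"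
  shows "\<exists>y\<in>topspace X. \<forall>a\<in>T. y \<in> near_class a (pt a)"
proof -
  define \<Q> where "\<Q> = (\<lambda>a. near_class a (pt a)) ` T"
  have classes: "\<Q> \<subseteq> (\<Union>a\<in>Field lam. near_class a ` topspace X)" "\<Q> \<noteq> {}"
    using T pt unfolding \<Q>_def by blast+
  have wo: "Well_order (superset_order \<Q>)"
    unfolding \<Q>_def using lam.WELL T(1) anti by (rule Well_order_superset_order_image)
  have "\<Inter>\<Q> \<noteq> {}"
    using spherical wo classes(2) ex_cball_above_smaller_classes[OF classes(1) wo]
    by (rule spherically_complete_metric_Inter)
  then show ?thesis using T(2) unfolding \<Q>_def near_class_def by blast
qed

sublocale spherical_partitions lam X near_class
  by unfold_locales (rule ex_in_all_near_classes)

end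

theorem theorem6p3:
  fixes lam :: "'l rel" and X :: "'a topology" and Y :: "'b topology" and xi :: "'l set"
  assumes "Card_order lam" and "natLeq <o lam" and "two_lt lam =o lam"
    and "regularCard lam"
    and "has_coinitiality TYPE('g::linordered_field) lam"
    and "M_class TYPE('g) lam X" and "M_class TYPE('g) lam Y"
    and "spherically_complete TYPE('g) Y"
    and "xi \<in> Field (cardSuc lam)" and "(oone (cardSuc lam), xi) \<in> cardSuc lam"
    and "is_successor (cardSuc lam) xi \<or>
         (is_limit (cardSuc lam) xi \<and> has_cofinality (cardSuc lam) xi lam)"
  shows "meas_fun lam X Y (osuc (cardSuc lam) xi) = lam_lim lam X Y (meas_fun lam X Y xi) \<and>
         (is_limit (cardSuc lam) xi \<longrightarrow>
          meas_fun lam X Y (osuc (cardSuc lam) xi) = lam_lim lam X Y (meas_fun_lt lam X Y xi))"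
proof -
  have "infinite (Field lam)"
    using assms(1,2) cinfinite_mono[OF ordLess_imp_ordLeq natLeq_cinfinite]
    by (simp add: cinfinite_def)
  with assms(1,3,4) interpret two_lt_cardinal lam by unfold_locales
  obtain dX :: "'a \<Rightarrow> 'a \<Rightarrow> 'g" where "compatible_G_metric X dX"
    using assms(6) unfolding M_class_def by blast
  with assms(2,5,6) interpret X: G_metric_space lam X dX
    by unfold_locales (simp_all add: M_class_def)
  obtain dY :: "'b \<Rightarrow> 'b \<Rightarrow> 'g" where "compatible_G_metric Y dY"
      "spherically_complete_metric (topspace Y) dY"
    using assms(8) unfolding spherically_complete_def by blast
  with assms(2,5,7) interpret Y: spherically_complete_space lam Y dY
    by unfold_locales (simp_all add: M_class_def)
  interpret measurable_limits lam X Y Y.near_class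
    by unfold_locales (rule X.openin_small_Inter)
  have "admissible_level xi" using assms(11) by (simp add: admissible_level_def)
  note limits = meas_fun_suc_eq_lam_lim[OF assms(10) this]
  show ?thesis
    using limits[OF X.meas_fun_successor_levels_subset subset_refl]
      limits[OF X.meas_fun_successor_levels_subset_lt X.meas_fun_lt_subset] by blast
qed

end
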